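(* Let $\pi$ be a prior density on $\Theta_k$, with associated prior probability measure $\Pi$, satisfying the following conditions. (A1) There exists $B>0$ such that $\pi(\theta)\le B$ for all $\theta\in\Theta_k$. (A2) $\pi$ is continuous almost everywhere with respect to volume measure, that is, $\mathrm{vol}(\Theta_{k,d})=0$. (A3) Each level set of the prior density is a null set with respect to the prior, that is, $\Pi(\{\theta:\pi(\theta)=l\})=0$ for every $l\ge 0$. If $\theta^{\text{true}}\in\Theta_{k,c}$, then, almost surely with respect to the data-generating process with probabilities $\theta^{\text{true}}$, $$M_{T_n}\big(\{\mathbf t: m_{T_n}(\mathbf t)\le m_{T_n}(T_n(x))\}\big)\longrightarrow \Pi\big(\{\theta:\pi(\theta)\le \pi(\theta^{\text{true}})\}\big)\quad\text{as } n\to\infty.$$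
   Context: Let $k\ge1$ and $\Theta_k=\{(\theta_1,\ldots,\theta_k):\theta_i>0,\ i=1,\ldots,k,\ \theta_1+\cdots+\theta_k<1\}$; for $\theta\in\Theta_k$ put $\theta_{k+1}=1-\theta_1-\cdots-\theta_k$. A prior is a probability measure $\Pi$ on $\Theta_k$ absolutely continuous with respect to volume (Lebesgue) measure, with a specified density function $\pi:\Theta_k\to[0,\infty)$. $\Theta_{k,c}$ and $\Theta_{k,d}$ denote the sets of continuity points and of discontinuity points of $\pi$ in $\Theta_k$. The data $x$ are i.i.d. draws from a distribution on $k+1$ categories with probabilities $\theta^{\text{true}}_1,\ldots,\theta^{\text{true}}_{k+1}$, where $\theta^{\text{true}}\in\Theta_k$ is fixed. $T_n=T_n(x)=(T_1,\ldots,T_k)$ denotes the observed counts of the first $k$ categories among the first $n$ draws. Possible values of $T_n$ are $\mathbf t=(t_1,\ldots,t_k)$ with nonnegative integer entries and $t_1+\cdots+t_k\le n$; put $t_{k+1}=n-t_1-\cdots-t_k$. The prior predictive probability function of $T_n$ is $$m_{T_n}(\mathbf t)=\frac{n!}{\prod_{j=1}^{k+1}t_j!}\int_{\Theta_k}\prod_{j=1}^{k+1}\theta_j^{t_j}\,\pi(\theta)\,d\theta,$$ and $M_{T_n}$ is the corresponding (discrete) probability measure. In $M_{T_n}(\{\mathbf t: m_{T_n}(\mathbf t)\le m_{T_n}(T_n(x))\})$ the observed $T_n(x)$ is held fixed and $\mathbf t\sim M_{T_n}$. *)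

theory Defs
  imports "HOL-Probability.Probability"
begin

text \<open>
  The dimension \<open>k \<ge> 1\<close> is \<open>CARD('k)\<close> for a finite index type \<open>'k\<close>.  The \<open>k + 1\<close>
  categories are the elements of \<open>'k option\<close>: \<open>Some i\<close> ranges over the first \<open>k\<close> of them,
  and \<open>None\<close> is the last one, whose probability and count are determined by the others.
\<close>

definition Theta :: "(real ^ 'k::finite) set" where
  "Theta = {\<theta>. (\<forall>i. \<theta> $ i > 0) \<and> (\<Sum>i\<in>UNIV. \<theta> $ i) < 1}"

definition cat_prob :: "real ^ 'k::finite \<Rightarrow> 'k option \<Rightarrow> real" where
  "cat_prob \<theta> c = (case c of Some i \<Rightarrow> \<theta> $ i | None \<Rightarrow> 1 - (\<Sum>i\<in>UNIV. \<theta> $ i))"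

text \<open>
  Densities are only required to be Lebesgue (not Borel) measurable, so the prior measure lives
  on the Lebesgue \<open>\<sigma>\<close>-algebra.  Values of a density outside \<open>Theta\<close> are irrelevant.
\<close>

definition prior_measure :: "(real ^ 'k::finite \<Rightarrow> real) \<Rightarrow> (real ^ 'k) measure" where
  "prior_measure \<pi> = density (lebesgue_on Theta) (\<lambda>\<theta>. ennreal (\<pi> \<theta>))"

definition prior_density :: "(real ^ 'k::finite \<Rightarrow> real) \<Rightarrow> bool" where
  "prior_density \<pi> \<longleftrightarrow>
     \<pi> \<in> borel_measurable (lebesgue_on Theta) \<and>
     (\<forall>\<theta>\<in>Theta. 0 \<le> \<pi> \<theta>) \<and>
     prob_space (prior_measure \<pi>)"

definition Theta_c :: "(real ^ 'k::finite \<Rightarrow> real) \<Rightarrow> (real ^ 'k) set" where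
  "Theta_c \<pi> = {\<theta>\<in>Theta. continuous (at \<theta> within Theta) \<pi>}"

definition Theta_d :: "(real ^ 'k::finite \<Rightarrow> real) \<Rightarrow> (real ^ 'k) set" where
  "Theta_d \<pi> = {\<theta>\<in>Theta. \<not> continuous (at \<theta> within Theta) \<pi>}"

definition count_vectors :: "nat \<Rightarrow> (nat ^ 'k::finite) set" where
  "count_vectors n = {t. (\<Sum>i\<in>UNIV. t $ i) \<le> n}"

definition cat_count :: "nat \<Rightarrow> nat ^ 'k::finite \<Rightarrow> 'k option \<Rightarrow> nat" where
  "cat_count n t c = (case c of Some i \<Rightarrow> t $ i | None \<Rightarrow> n - (\<Sum>i\<in>UNIV. t $ i))"

definition observed_counts :: "(nat \<Rightarrow> 'k::finite option) \<Rightarrow> nat \<Rightarrow> nat ^ 'k" where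
  "observed_counts x n = (\<chi> i. card {j. j < n \<and> x j = Some i})"

definition prior_pred :: "(real ^ 'k::finite \<Rightarrow> real) \<Rightarrow> nat \<Rightarrow> nat ^ 'k \<Rightarrow> real" where
  "prior_pred \<pi> n t =
     fact n / (\<Prod>c\<in>UNIV. fact (cat_count n t c)) *
     (LINT \<theta>|lebesgue_on Theta. (\<Prod>c\<in>UNIV. cat_prob \<theta> c ^ cat_count n t c) * \<pi> \<theta>)"

definition prior_pred_measure :: "(real ^ 'k::finite \<Rightarrow> real) \<Rightarrow> nat \<Rightarrow> (nat ^ 'k) measure" where
  "prior_pred_measure \<pi> n = point_measure (count_vectors n) (\<lambda>t. ennreal (prior_pred \<pi> n t))"

end

theory Submission
  imports Defs
begin

text \<open>
  For counts \<open>s\<close> of the \<open>k + 1\<close> categories with total \<open>n\<close>, the prior predictive probability is the integral over the simplex of \<open>\<pi>\<close> against a multinomial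
  coefficient times \<open>\<Prod>\<^sub>c \<theta>\<^sub>c ^ s\<^sub>c\<close>.  By Dirichlet's formula
  \<open>\<integral> \<Prod>\<^sub>c \<theta>\<^sub>c ^ s\<^sub>c d\<theta> = k! (\<Prod>\<^sub>c s\<^sub>c!) vol(\<Theta>) / (n + k)!\<close>
  (\<open>dirichlet_integral_eq\<close>) the weights have the same integral for all \<open>s\<close> with total \<open>n\<close>.  So up
  to a positive factor that depends on \<open>n\<close> alone, the prior predictive probability is the mean of
  \<open>\<pi>\<close> under the Dirichlet distribution with parameters \<open>s\<^sub>c + 1\<close>
  (\<open>prior_pred_eq_dirichlet_mean\<close>), and the comparison of two prior predictive probabilities is
  the comparison of two such means.

  This Dirichlet distribution has variances of order \<open>1/n\<close> and is centred near \<open>s/n\<close>.  Hence its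
  mean of a bounded density is close to \<open>\<pi> p\<close> whenever \<open>n\<close> is large, \<open>s/n\<close> is close to \<open>p\<close> and \<open>\<pi>\<close>
  is continuous at \<open>p\<close> (\<open>dirichlet_mean_near\<close>).  The law of large numbers is used on both sides of
  the comparison.  By the strong law the observed frequencies converge to the true point, so the
  observed mean converges to \<open>l = \<pi> \<theta>true\<close>.  Under the prior predictive
  measure the counts are drawn by first drawing \<open>\<theta>\<close> from the prior and then multinomial counts given
  \<open>\<theta>\<close> (\<open>prior_pred_measure_eq_integral\<close>).  Given a continuity point \<open>\<theta>\<close> with \<open>\<pi> \<theta> \<noteq> l\<close>, the
  weak law for these counts makes the conditional probability of the region tend to \<open>1\<close> or \<open>0\<close>
  according to whether \<open>\<pi> \<theta> < l\<close> or \<open>\<pi> \<theta> > l\<close> (\<open>region_probability_tendsto\<close>).  Discontinuity points are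
  Lebesgue null, the level set \<open>\<pi> \<theta> = l\<close> is null for the prior, and dominated convergence
  integrates the conditional probabilities to the claim.

  Both families of moments come from a size-bias identity: weighting by the count \<open>s\<^sub>c\<close>
  (multinomial) or by the coordinate \<open>\<theta>\<^sub>c\<close> (Dirichlet) amounts to moving one draw of category \<open>c\<close>
  into or out of the sample.
\<close>

section \<open>Moments and concentration of multinomial counts\<close>

definition weak_compositions :: "nat \<Rightarrow> ('c::finite \<Rightarrow> nat) set" where
  "weak_compositions n = {s. sum s UNIV = n}"

definition monomial :: "('c::finite \<Rightarrow> real) \<Rightarrow> ('c \<Rightarrow> nat) \<Rightarrow> real" where
  "monomial p s = (\<Prod>c\<in>UNIV. p c ^ s c)"

definition add_draw :: "'c \<Rightarrow> ('c \<Rightarrow> nat) \<Rightarrow> 'c \<Rightarrow> nat" where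
  "add_draw c s = s(c := Suc (s c))"

definition multinomial :: "('c::finite \<Rightarrow> real) \<Rightarrow> ('c \<Rightarrow> nat) \<Rightarrow> real" where
  "multinomial p s = fact (sum s UNIV) / (\<Prod>c\<in>UNIV. fact (s c)) * monomial p s"

lemma finite_weak_compositions: "finite (weak_compositions n :: ('c::finite \<Rightarrow> nat) set)"
proof (rule finite_subset)
  show "weak_compositions n \<subseteq> (PiE UNIV (\<lambda>_. {..n}) :: ('c \<Rightarrow> nat) set)"
    by (auto simp: weak_compositions_def intro: member_le_sum)
qed (auto intro: finite_PiE)

text \<open>
  Adding a draw changes a single factor of a product over the categories; powers and factorials
  are the two cases of interest.
\<close>

lemma prod_add_draw:
  fixes f :: "'c::finite \<Rightarrow> nat \<Rightarrow> 'b::comm_semiring_1"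
  assumes "f c (Suc (s c)) = a * f c (s c)"
  shows "(\<Prod>d\<in>UNIV. f d (add_draw c s d)) = a * (\<Prod>d\<in>UNIV. f d (s d))"
proof -
  have "(\<Prod>d\<in>UNIV. f d (add_draw c s d)) = f c (Suc (s c)) * (\<Prod>d\<in>UNIV - {c}. f d (s d))"
    by (subst prod.remove[of UNIV c]) (auto simp: add_draw_def intro!: prod.cong arg_cong2[where f = "(*)"])
  also have "\<dots> = a * (\<Prod>d\<in>UNIV. f d (s d))"
    using assms by (subst prod.remove[of UNIV c]) (auto simp: mult.assoc)
  finally show ?thesis .
qed

lemma monomial_add_draw: "monomial p (add_draw c s) = p c * monomial p s"
  unfolding monomial_def by (rule prod_add_draw) simp

lemma fact_prod_add_draw:
  "(\<Prod>d\<in>UNIV. fact (add_draw c s d) :: real) = real (Suc (s c)) * (\<Prod>d\<in>(UNIV::'c::finite set). fact (s d))"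
  by (rule prod_add_draw[of "\<lambda>_. fact"]) simp

lemma sum_add_draw: "sum (add_draw c s) UNIV = Suc (sum s (UNIV::'c::finite set))"
proof -
  have "sum (add_draw c s) UNIV = add_draw c s c + sum (add_draw c s) (UNIV - {c})"
    by (rule sum.remove) auto
  also have "\<dots> = Suc (s c + sum s (UNIV - {c}))" by (simp add: add_draw_def)
  also have "s c + sum s (UNIV - {c}) = sum s UNIV" by (rule sum.remove[symmetric]) auto
  finally show ?thesis .
qed

lemma multinomial_add_draw:
  "real (Suc (s c)) * multinomial p (add_draw c s) = real (Suc (sum s UNIV)) * p c * multinomial p s"
  unfolding multinomial_def monomial_add_draw fact_prod_add_draw sum_add_draw
  by (simp add: field_simps del: of_nat_Suc)

lemma multinomial_nonneg: "(\<And>c. p c \<ge> 0) \<Longrightarrow> multinomial p s \<ge> 0"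
  unfolding multinomial_def monomial_def by (intro mult_nonneg_nonneg divide_nonneg_nonneg prod_nonneg) auto

text \<open>
  A finite sum rather than an integral over a measure: the size-bias identity below gives every
  moment that is used, the total mass included, from the weights alone.
\<close>

definition multinomial_mean :: "('c::finite \<Rightarrow> real) \<Rightarrow> nat \<Rightarrow> (('c \<Rightarrow> nat) \<Rightarrow> real) \<Rightarrow> real" where
  "multinomial_mean p n f = (\<Sum>s\<in>weak_compositions n. multinomial p s * f s)"

text \<open>
  Absorption: \<open>s\<^sub>c\<close> times the multinomial coefficient of \<open>s\<close> is \<open>n + 1\<close> times the coefficient
  of \<open>s\<close> with one draw of category \<open>c\<close> removed.  Counts with \<open>s\<^sub>c = 0\<close> contribute nothing, and the
  others are exactly the images under \<open>add_draw c\<close>.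
\<close>

lemma multinomial_mean_size_bias:
  "multinomial_mean p (Suc n) (\<lambda>s. real (s c) * f s)
     = real (Suc n) * p c * multinomial_mean p n (\<lambda>s. f (add_draw c s))"
proof -
  let ?W = "{s\<in>weak_compositions (Suc n). s c > 0}"
  have img: "?W = add_draw c ` weak_compositions n"
  proof (intro set_eqI iffI)
    fix s assume s: "s \<in> ?W"
    then have "add_draw c (s(c := s c - 1)) = s" by (auto simp: add_draw_def)
    with s show "s \<in> add_draw c ` weak_compositions n"
      using sum_add_draw[of c "s(c := s c - 1)"]
      by (intro image_eqI[of _ _ "s(c := s c - 1)"]) (auto simp: weak_compositions_def)
  qed (auto simp: weak_compositions_def sum_add_draw, auto simp: add_draw_def)
  have inj: "inj_on (add_draw c) (weak_compositions n)"
  proof (rule inj_onI)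
    fix s s' assume eq: "add_draw c s = add_draw c s'"
    have "s d = s' d" for d using fun_cong[OF eq, of d] by (auto simp: add_draw_def split: if_splits)
    then show "s = s'" by auto
  qed
  have "multinomial_mean p (Suc n) (\<lambda>s. real (s c) * f s) = (\<Sum>s\<in>?W. multinomial p s * (real (s c) * f s))"
    unfolding multinomial_mean_def
    by (rule sum.mono_neutral_right) (auto simp: finite_weak_compositions)
  also have "\<dots> = (\<Sum>s\<in>weak_compositions n.
      multinomial p (add_draw c s) * (real (add_draw c s c) * f (add_draw c s)))"
    unfolding img by (subst sum.reindex[OF inj]) simp
  also have "\<dots> = (\<Sum>s\<in>weak_compositions n. real (Suc n) * p c * (multinomial p s * f (add_draw c s)))"
  proof (rule sum.cong)
    fix s :: "'a \<Rightarrow> nat" assume "s \<in> weak_compositions n"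
    then have n: "sum s UNIV = n" by (simp add: weak_compositions_def)
    have "multinomial p (add_draw c s) * (real (add_draw c s c) * f (add_draw c s))
        = (real (Suc (s c)) * multinomial p (add_draw c s)) * f (add_draw c s)"
      by (simp add: add_draw_def)
    then show "multinomial p (add_draw c s) * (real (add_draw c s c) * f (add_draw c s))
        = real (Suc n) * p c * (multinomial p s * f (add_draw c s))"
      unfolding multinomial_add_draw n by simp
  qed simp
  finally show ?thesis by (simp add: multinomial_mean_def sum_distrib_left)
qed

lemma multinomial_mean_add:
  "multinomial_mean p n (\<lambda>s. f s + g s) = multinomial_mean p n f + multinomial_mean p n g"
  by (simp add: multinomial_mean_def algebra_simps sum.distrib)

lemma multinomial_mean_cmult:
  "multinomial_mean p n (\<lambda>s. a * f s) = a * multinomial_mean p n f"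
  by (simp add: multinomial_mean_def sum_distrib_left algebra_simps)

text \<open>
  The multinomial theorem for probabilities, by induction on the number of draws: the total count
  \<open>n + 1\<close> is the sum of the \<open>s\<^sub>c\<close>, and size-biasing each of these reduces to \<open>n\<close> draws.
\<close>

lemma multinomial_mean_1:
  assumes "(\<Sum>c\<in>UNIV. p c) = 1"
  shows "multinomial_mean p n (\<lambda>_. 1) = 1"
proof (induction n)
  case 0
  have "weak_compositions 0 = {\<lambda>_::'a. 0::nat}" by (auto simp: weak_compositions_def)
  then show ?case by (simp add: multinomial_mean_def multinomial_def monomial_def)
next
  case (Suc n)
  have "real (Suc n) * multinomial_mean p (Suc n) (\<lambda>_. 1)
      = (\<Sum>s\<in>weak_compositions (Suc n). multinomial p s * real (sum s UNIV))"
    unfolding multinomial_mean_cmult[symmetric] unfolding multinomial_mean_def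
    by (intro sum.cong) (auto simp: weak_compositions_def)
  also have "\<dots> = (\<Sum>c\<in>UNIV. multinomial_mean p (Suc n) (\<lambda>s. real (s c) * 1))"
    unfolding multinomial_mean_def by (subst sum.swap) (simp add: sum_distrib_left)
  also have "\<dots> = (\<Sum>c\<in>UNIV. real (Suc n) * p c * multinomial_mean p n (\<lambda>s. 1))"
    by (simp only: multinomial_mean_size_bias)
  also have "\<dots> = real (Suc n)"
    using assms by (simp add: Suc.IH sum_distrib_left[symmetric] del: of_nat_Suc)
  finally show ?case by simp
qed

lemma multinomial_mean_square_deviation:
  assumes "(\<Sum>c\<in>UNIV. p c) = 1"
  shows "multinomial_mean p (Suc n) (\<lambda>s. (real (s c) / real (Suc n) - p c)\<^sup>2)
       = p c * (1 - p c) / real (Suc n)"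
proof -
  note size_bias = multinomial_mean_size_bias and one = multinomial_mean_1[OF assms]
  have first: "multinomial_mean p m (\<lambda>s. real (s c)) = real m * p c" for m
  proof (cases m)
    case 0
    then show ?thesis by (auto simp: multinomial_mean_def weak_compositions_def)
  next
    case (Suc n)
    then show ?thesis using size_bias[of p n c "\<lambda>_. 1"] by (simp add: one)
  qed
  have second: "multinomial_mean p (Suc n) (\<lambda>s. real (s c) * real (s c))
      = real (Suc n) * p c * (real n * p c + 1)"
    unfolding size_bias by (simp add: add_draw_def multinomial_mean_add first one)
  let ?N = "real (Suc n)"
  have "multinomial_mean p (Suc n) (\<lambda>s. (real (s c) / ?N - p c)\<^sup>2)
      = multinomial_mean p (Suc n) (\<lambda>s. 1 / ?N\<^sup>2 * (real (s c) * real (s c))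
          + (- 2 * p c / ?N * real (s c) + (p c)\<^sup>2 * 1))"
    by (intro arg_cong[where f = "multinomial_mean p (Suc n)"] ext)
       (simp add: power2_eq_square field_simps del: of_nat_Suc)
  also have "\<dots> = 1 / ?N\<^sup>2 * (?N * p c * ((?N - 1) * p c + 1)) + (- 2 * p c / ?N * (?N * p c) + (p c)\<^sup>2)"
    unfolding multinomial_mean_add multinomial_mean_cmult first second one by simp
  also have "\<dots> = p c * (1 - p c) / ?N"
    by (simp add: power2_eq_square field_simps del: of_nat_Suc)
  finally show ?thesis .
qed

lemma multinomial_mean_mono:
  assumes "\<And>c. p c \<ge> 0" "\<And>s. s \<in> weak_compositions n \<Longrightarrow> f s \<le> g s"
  shows "multinomial_mean p n f \<le> multinomial_mean p n g"
  unfolding multinomial_mean_def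
  by (intro sum_mono mult_left_mono assms multinomial_nonneg)

lemma multinomial_mean_sum:
  "multinomial_mean p n (\<lambda>s. \<Sum>i\<in>I. f i s) = (\<Sum>i\<in>I. multinomial_mean p n (f i))"
  unfolding multinomial_mean_def sum_distrib_left by (rule sum.swap)

text \<open>
  Chebyshev's inequality for a statistic \<open>f\<close> that takes the value \<open>b\<close> when all frequencies are
  within \<open>\<delta>\<close> of their probabilities: otherwise some squared deviation is at least \<open>\<delta>\<^sup>2\<close>, so
  \<open>\<bar>f - b\<bar>\<close> is always at most the sum of the squared deviations divided by \<open>\<delta>\<^sup>2\<close>.
\<close>

lemma multinomial_concentration:
  fixes p :: "'c::finite \<Rightarrow> real"
  assumes p: "\<And>c. p c \<ge> 0" "(\<Sum>c\<in>UNIV. p c) = 1"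
    and n: "n > 0" and \<delta>: "\<delta> > 0"
    and near: "\<And>s. s \<in> weak_compositions n \<Longrightarrow>
        (\<forall>c. \<bar>real (s c) / real n - p c\<bar> < \<delta>) \<Longrightarrow> f s = b"
    and dev: "\<And>s. \<bar>f s - b\<bar> \<le> 1"
  shows "\<bar>multinomial_mean p n f - b\<bar> \<le> real CARD('c) / \<delta>\<^sup>2 * (1 / real n)"
proof -
  define D where "D s = 1 / \<delta>\<^sup>2 * (\<Sum>c\<in>UNIV. (real (s c) / real n - p c)\<^sup>2)" for s
  have D: "\<bar>f s - b\<bar> \<le> D s" if s: "s \<in> weak_compositions n" for s
  proof (cases "\<forall>c. \<bar>real (s c) / real n - p c\<bar> < \<delta>")
    case True
    have "0 \<le> D s" unfolding D_def by (intro mult_nonneg_nonneg sum_nonneg) auto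
    then show ?thesis using near[OF s True] by simp
  next
    case False
    then obtain c where c: "\<delta> \<le> \<bar>real (s c) / real n - p c\<bar>" by (auto simp: not_less)
    have "\<delta>\<^sup>2 \<le> \<bar>real (s c) / real n - p c\<bar>\<^sup>2" using c \<delta> by (intro power_mono) auto
    also have "\<dots> \<le> (\<Sum>c\<in>UNIV. (real (s c) / real n - p c)\<^sup>2)"
      unfolding power2_abs by (rule member_le_sum[of _ _ "\<lambda>c. (real (s c) / real n - p c)\<^sup>2"]) auto
    finally have "1 \<le> D s" using \<delta> by (simp add: D_def)
    then show ?thesis using dev[of s] by linarith
  qed
  have unit: "p c \<le> 1" for c
    using member_le_sum[of c UNIV p] p by simp
  obtain m where m: "n = Suc m" using n by (cases n) auto
  have "multinomial_mean p n D = 1 / \<delta>\<^sup>2 * (\<Sum>c\<in>UNIV. p c * (1 - p c) / real n)"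
    unfolding D_def multinomial_mean_cmult multinomial_mean_sum m
      multinomial_mean_square_deviation[OF p(2)] ..
  also have "\<dots> \<le> 1 / \<delta>\<^sup>2 * (\<Sum>c\<in>(UNIV::'c set). 1 / real n)"
  proof (intro mult_left_mono sum_mono divide_right_mono)
    fix c show "p c * (1 - p c) \<le> 1" using p(1)[of c] unit[of c] by (intro mult_le_one) auto
  qed auto
  finally have DD: "multinomial_mean p n D \<le> real CARD('c) / \<delta>\<^sup>2 * (1 / real n)" by simp
  have "multinomial_mean p n (\<lambda>s. f s + (- b) * 1) = multinomial_mean p n f - b"
    unfolding multinomial_mean_add multinomial_mean_cmult multinomial_mean_1[OF p(2)] by simp
  moreover have "multinomial_mean p n (\<lambda>s. f s + (- b) * 1) \<le> multinomial_mean p n D"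
    by (rule multinomial_mean_mono[OF p(1)]) (use D in \<open>force simp: abs_le_iff\<close>)
  moreover have "multinomial_mean p n (\<lambda>s. (-1) * D s) \<le> multinomial_mean p n (\<lambda>s. f s + (- b) * 1)"
    by (rule multinomial_mean_mono[OF p(1)]) (use D in \<open>force simp: abs_le_iff\<close>)
  ultimately show ?thesis using DD unfolding multinomial_mean_cmult by (simp add: abs_le_iff)
qed

lemma multinomial_mean_indicator_bounds:
  assumes "\<And>c. p c \<ge> 0" "(\<Sum>c\<in>UNIV. p c) = 1"
  shows "0 \<le> multinomial_mean p n (indicator S)" "multinomial_mean p n (indicator S) \<le> 1"
proof -
  have "multinomial_mean p n (\<lambda>_. 0) \<le> multinomial_mean p n (indicator S)"
    by (rule multinomial_mean_mono) (use assms in auto)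
  then show "0 \<le> multinomial_mean p n (indicator S)" by (simp add: multinomial_mean_def)
  have "multinomial_mean p n (indicator S) \<le> multinomial_mean p n (\<lambda>_. 1)"
    by (rule multinomial_mean_mono) (use assms in auto)
  then show "multinomial_mean p n (indicator S) \<le> 1" by (simp add: multinomial_mean_1 assms)
qed

section \<open>The open probability simplex\<close>

lemma sum_cat_prob: "(\<Sum>c\<in>UNIV. cat_prob \<theta> c) = 1"
  by (simp add: UNIV_option_conv sum.reindex cat_prob_def)

lemma cat_prob_in_unit:
  assumes "\<theta> \<in> Theta"
  shows "0 < cat_prob \<theta> c" "cat_prob \<theta> c \<le> 1"
proof -
  have pos: "0 < cat_prob \<theta> d" for d
    using assms by (cases d) (auto simp: Theta_def cat_prob_def)
  show "0 < cat_prob \<theta> c" by (rule pos)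
  have "cat_prob \<theta> c \<le> (\<Sum>d\<in>UNIV. cat_prob \<theta> d)"
    by (rule member_le_sum) (auto intro: less_imp_le pos)
  then show "cat_prob \<theta> c \<le> 1" by (simp add: sum_cat_prob)
qed

lemma Theta_eq: "Theta = {\<theta>. \<forall>c. 0 < cat_prob \<theta> c}"
  by (auto simp: Theta_def cat_prob_def split: option.splits)

lemma continuous_cat_prob [continuous_intros]:
  "continuous_on A (\<lambda>\<theta>::real^'k::finite. cat_prob \<theta> c)"
  unfolding cat_prob_def by (cases c) (auto intro!: continuous_intros)

lemma borel_measurable_cat_prob [measurable]:
  "(\<lambda>\<theta>::real^'k::finite. cat_prob \<theta> c) \<in> borel_measurable borel"
  by (intro borel_measurable_continuous_onI continuous_intros)

lemma open_Theta: "open (Theta :: (real^'k::finite) set)"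
proof -
  have "open (\<Inter>c\<in>UNIV. {\<theta> :: real^'k. 0 < cat_prob \<theta> c})"
    by (intro open_INT finite ballI open_Collect_less continuous_intros)
  also have "(\<Inter>c\<in>UNIV. {\<theta> :: real^'k. 0 < cat_prob \<theta> c}) = Theta"
    by (auto simp: Theta_eq)
  finally show ?thesis .
qed

lemma sets_Theta [measurable]: "(Theta :: (real^'k::finite) set) \<in> sets borel"
  by (rule borel_open[OF open_Theta])

lemma Theta_lmeasurable_set: "(Theta :: (real^'k::finite) set) \<in> sets lebesgue"
  using sets_Theta by simp

lemma Theta_subset_cbox: "(Theta :: (real^'k::finite) set) \<subseteq> cbox 0 1"
proof
  fix \<theta> :: "real^'k" assume \<theta>: "\<theta> \<in> Theta"
  show "\<theta> \<in> cbox 0 1"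
    using cat_prob_in_unit[OF \<theta>, of "Some _"] by (auto simp: mem_box_cart cat_prob_def less_imp_le)
qed

lemma bounded_Theta: "bounded (Theta :: (real^'k::finite) set)"
  using Theta_subset_cbox bounded_cbox bounded_subset by blast

lemma Theta_lmeasurable: "(Theta :: (real^'k::finite) set) \<in> lmeasurable"
  by (intro lmeasurable_open bounded_Theta open_Theta)

lemma finite_measure_Theta: "finite_measure (lebesgue_on (Theta :: (real^'k::finite) set))"
  by (intro finite_measureI) (use fmeasurableD2[OF Theta_lmeasurable] Theta_lmeasurable_set in \<open>simp add: emeasure_restrict_space\<close>)

lemma convex_Theta: "convex (Theta :: (real^'k::finite) set)"
proof (rule convexI)
  fix x y :: "real^'k" and u v :: real
  assume xy: "x \<in> Theta" "y \<in> Theta" and uv: "0 \<le> u" "0 \<le> v" "u + v = 1"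
  have "cat_prob (u *\<^sub>R x + v *\<^sub>R y) c = u * cat_prob x c + v * cat_prob y c" for c
  proof (cases c)
    case None
    have "1 - (u * a + v * b) = u * (1 - a) + v * (1 - b)" for a b :: real
      using uv(3) by (simp add: algebra_simps flip: distrib_right)
    with None show ?thesis by (simp add: cat_prob_def sum.distrib flip: sum_distrib_left)
  qed (simp add: cat_prob_def)
  moreover have "0 < u * cat_prob x c + v * cat_prob y c" for c
    using cat_prob_in_unit(1)[OF xy(1), of c] cat_prob_in_unit(1)[OF xy(2), of c] uv
    by (cases "u = 0") (auto intro: add_pos_nonneg)
  ultimately show "u *\<^sub>R x + v *\<^sub>R y \<in> Theta" by (simp add: Theta_eq)
qed

lemma AE_not_frontier_Theta: "AE x in lborel. x \<notin> frontier (Theta :: (real^'k::finite) set)"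
proof -
  have "frontier (Theta :: (real^'k) set) \<in> null_sets lebesgue"
    using negligible_convex_frontier[OF convex_Theta] by (simp add: negligible_iff_null_sets)
  then have "frontier (Theta :: (real^'k) set) \<in> null_sets lborel"
    by (simp add: null_sets_def)
  then show ?thesis by (rule AE_not_in)
qed

lemma monomial_measurable [measurable]:
  "(\<lambda>\<theta>::real^'k::finite. monomial (cat_prob \<theta>) s) \<in> borel_measurable borel"
  unfolding monomial_def by measurable

lemma monomial_bounds:
  assumes "\<theta> \<in> Theta"
  shows "0 < monomial (cat_prob \<theta>) s" "monomial (cat_prob \<theta>) s \<le> 1"
proof -
  note unit = cat_prob_in_unit[OF assms]
  show "0 < monomial (cat_prob \<theta>) s"
    unfolding monomial_def by (intro prod_pos zero_less_power ballI unit)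
  show "monomial (cat_prob \<theta>) s \<le> 1"
    unfolding monomial_def
    by (intro prod_le_1 conjI power_le_one zero_le_power) (use unit in \<open>auto intro: less_imp_le\<close>)
qed

lemma integrable_on_Theta:
  fixes f :: "real^'k::finite \<Rightarrow> real"
  assumes "f \<in> borel_measurable (lebesgue_on Theta)" "\<And>\<theta>. \<theta> \<in> Theta \<Longrightarrow> \<bar>f \<theta>\<bar> \<le> C"
  shows "integrable (lebesgue_on Theta) f"
proof -
  interpret finite_measure "lebesgue_on (Theta :: (real^'k) set)" by (rule finite_measure_Theta)
  show ?thesis
    by (rule integrable_const_bound[of _ C]) (use assms in \<open>auto intro!: AE_I2\<close>)
qed

lemma borel_measurable_on_Theta:
  fixes f :: "real^'k::finite \<Rightarrow> real"
  assumes "f \<in> borel_measurable borel"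
  shows "f \<in> borel_measurable (lebesgue_on Theta)"
  by (intro measurable_restrict_space1 measurable_completion) (use assms in simp)

section \<open>Dirichlet's integral\<close>

definition dirichlet_integral :: "('k::finite option \<Rightarrow> nat) \<Rightarrow> real" where
  "dirichlet_integral s = (LINT \<theta>|lebesgue_on Theta. monomial (cat_prob \<theta>) s)"

lemma integrable_monomial:
  "integrable (lebesgue_on (Theta :: (real^'k::finite) set)) (\<lambda>\<theta>. monomial (cat_prob \<theta>) s)"
proof (rule integrable_on_Theta[where C = 1])
  show "(\<lambda>\<theta>::real^'k. monomial (cat_prob \<theta>) s) \<in> borel_measurable (lebesgue_on Theta)"
    by (intro borel_measurable_on_Theta) measurable
  fix \<theta> :: "real^'k" assume "\<theta> \<in> Theta"
  then show "\<bar>monomial (cat_prob \<theta>) s\<bar> \<le> 1" using monomial_bounds[of \<theta> s] by simp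
qed

lemma lebesgue_on_Theta_integral:
  fixes f :: "real^'k::finite \<Rightarrow> real"
  assumes [measurable]: "f \<in> borel_measurable borel"
  shows "(LINT \<theta>|lebesgue_on Theta. f \<theta>) = (LINT \<theta>|lborel. indicator Theta \<theta> * f \<theta>)"
proof -
  have "(LINT \<theta>|lebesgue_on Theta. f \<theta>) = (LINT \<theta>|lebesgue. indicator Theta \<theta> * f \<theta>)"
    by (subst integral_restrict_space) (simp_all add: sets_Theta)
  also have "\<dots> = (LINT \<theta>|lborel. indicator Theta \<theta> * f \<theta>)"
    by (rule integral_completion) measurable
  finally show ?thesis .
qed

lemma lborel_integral_difference_zero:
  fixes F :: "'a::euclidean_space \<Rightarrow> real"
  assumes "integrable lborel F"
  shows "(LINT x|lborel. F (v + x) - F x) = 0"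
proof -
  have [measurable]: "F \<in> borel_measurable borel" using assms by auto
  have int: "integrable (distr lborel borel ((+) v)) F"
    using assms by (simp add: lborel_distr_plus)
  then have i: "integrable lborel (\<lambda>x. F (v + x))"
    by (subst (asm) integrable_distr_eq) auto
  have "(LINT x|lborel. F (v + x)) = (LINT x|distr lborel borel ((+) v). F x)"
    by (subst integral_distr) auto
  then have "(LINT x|lborel. F (v + x)) = (LINT x|lborel. F x)"
    by (simp add: lborel_distr_plus)
  with i assms show ?thesis by simp
qed

lemma cat_prob_shift:
  "cat_prob (h *\<^sub>R axis i 1 + x) c = cat_prob x c + h * (if c = Some i then 1 else if c = None then -1 else 0)"
  by (cases c) (auto simp: cat_prob_def sum.distrib axis_def if_distrib[of "\<lambda>x. _ * x"] cong: if_cong)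

text \<open>
  The exponents of the coordinates \<open>i\<close> and \<open>None\<close> are raised by one so that the function vanishes on
  the two faces of the simplex that a line in direction \<open>i\<close> crosses.  It is therefore Lipschitz along
  such lines although it is extended by zero.
\<close>

definition simplex_bump :: "'k::finite \<Rightarrow> ('k option \<Rightarrow> nat) \<Rightarrow> real^'k \<Rightarrow> real" where
  "simplex_bump i s x = indicator Theta x * monomial (cat_prob x) (add_draw (Some i) (add_draw None s))"

text \<open>
  Off the simplex, if the coordinates other than \<open>i\<close> are positive then the coordinate of \<open>Some i\<close> or of
  \<open>None\<close> is nonpositive, and its clipped value kills the product.  Clipping to \<open>[0, 1]\<close> thus
  replaces the indicator of the simplex, which makes the Lipschitz bound a product estimate.
\<close>

lemma simplex_bump_clipped:
  fixes x :: "real^'k::finite"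
  assumes "\<And>j. j \<noteq> i \<Longrightarrow> 0 < x $ j"
  shows "simplex_bump i s x
    = monomial (\<lambda>c. max 0 (min 1 (cat_prob x c))) (add_draw (Some i) (add_draw None s))"
proof (cases "x \<in> Theta")
  case True
  then have "(\<lambda>c. max 0 (min 1 (cat_prob x c))) = cat_prob x"
    using cat_prob_in_unit[OF True] by (simp add: fun_eq_iff less_imp_le max_absorb2 min_absorb2)
  then show ?thesis using True by (simp add: simplex_bump_def)
next
  case False
  then obtain c where c: "cat_prob x c \<le> 0" by (auto simp: Theta_eq not_less)
  then have "c = Some i \<or> c = None"
    using assms by (cases c) (auto simp: cat_prob_def not_less[symmetric])
  then have "max 0 (min 1 (cat_prob x c)) ^ add_draw (Some i) (add_draw None s) c = 0"
    using c by (auto simp: add_draw_def max_def min_def)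
  then have "monomial (\<lambda>c. max 0 (min 1 (cat_prob x c))) (add_draw (Some i) (add_draw None s)) = 0"
    unfolding monomial_def by (intro prod_zero) auto
  then show ?thesis using False by (simp add: simplex_bump_def)
qed

lemma monomial_lipschitz:
  assumes "\<And>c. \<bar>p c - q c\<bar> \<le> h" "\<And>c. 0 \<le> p c \<and> p c \<le> 1" "\<And>c. 0 \<le> q c \<and> q c \<le> 1"
  shows "\<bar>monomial p s - monomial q s\<bar> \<le> real (sum s UNIV) * h"
proof -
  have "norm (monomial p s - monomial q s) \<le> (\<Sum>c\<in>UNIV. norm (p c ^ s c - q c ^ s c))"
    unfolding monomial_def
    by (rule norm_prod_diff) (use assms in \<open>auto simp: norm_power power_le_one\<close>)
  also have "\<dots> \<le> (\<Sum>c\<in>UNIV. real (s c) * h)"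
  proof (rule sum_mono)
    fix c
    have "norm (p c ^ s c - q c ^ s c) \<le> real (s c) * norm (p c - q c)"
      by (rule norm_power_diff) (use assms in auto)
    also have "\<dots> \<le> real (s c) * h" using assms(1)[of c] by (intro mult_left_mono) auto
    finally show "norm (p c ^ s c - q c ^ s c) \<le> real (s c) * h" .
  qed
  finally show ?thesis by (simp add: sum_distrib_right)
qed

text \<open>
  The shift leaves every coordinate other than \<open>i\<close> and \<open>None\<close> fixed.  If one of these is nonpositive,
  both points lie outside the simplex; otherwise the clipped form applies to both.
\<close>

lemma simplex_bump_lipschitz:
  fixes x :: "real^'k::finite"
  assumes h: "0 \<le> h"
  shows "\<bar>simplex_bump i s (h *\<^sub>R axis i 1 + x) - simplex_bump i s x\<bar> \<le> real (sum s UNIV + 2) * h"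
proof (cases "\<forall>j. j \<noteq> i \<longrightarrow> 0 < x $ j")
  case True
  let ?y = "h *\<^sub>R axis i 1 + x"
  have y: "\<And>j. j \<noteq> i \<Longrightarrow> 0 < ?y $ j" using True by (auto simp: axis_def)
  let ?e = "add_draw (Some i) (add_draw None s)"
  have "\<bar>monomial (\<lambda>c. max 0 (min 1 (cat_prob ?y c))) ?e - monomial (\<lambda>c. max 0 (min 1 (cat_prob x c))) ?e\<bar>
     \<le> real (sum ?e UNIV) * h"
  proof (rule monomial_lipschitz)
    fix c
    show "\<bar>max 0 (min 1 (cat_prob ?y c)) - max 0 (min 1 (cat_prob x c))\<bar> \<le> h"
      unfolding cat_prob_shift using h by (auto simp: max_def min_def)
  qed auto
  then show ?thesis
    using True y by (simp add: simplex_bump_clipped sum_add_draw)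
next
  case False
  then obtain j where j: "j \<noteq> i" "x $ j \<le> 0" by (auto simp: not_less)
  then have "x \<notin> Theta" "h *\<^sub>R axis i 1 + x \<notin> Theta"
    by (auto simp: Theta_def axis_def not_less intro!: exI[of _ j])
  moreover have "0 \<le> real (sum s UNIV + 2) * h" using h by (intro mult_nonneg_nonneg of_nat_0_le_iff)
  ultimately show ?thesis by (simp add: simplex_bump_def)
qed

lemma simplex_bump_derivative:
  fixes x :: "real^'k::finite"
  assumes x: "x \<in> Theta"
  shows "((\<lambda>h. simplex_bump i s (h *\<^sub>R axis i 1 + x)) has_real_derivative
    real (Suc (s (Some i))) * monomial (cat_prob x) (add_draw None s)
    - real (Suc (s None)) * monomial (cat_prob x) (add_draw (Some i) s)) (at 0)"
proof -
  define R where "R = (\<Prod>c\<in>UNIV - {None} - {Some i}. cat_prob x c ^ s c)"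
  have split: "monomial q r = q None ^ r None * (q (Some i) ^ r (Some i) *
      (\<Prod>c\<in>UNIV - {None} - {Some i}. q c ^ r c))" for q :: "'k option \<Rightarrow> real" and r
    unfolding monomial_def by (subst prod.remove[of _ None], simp, simp, subst prod.remove[of _ "Some i"]) auto
  let ?a = "cat_prob x (Some i)" and ?b = "cat_prob x None"
  let ?m = "s (Some i)" and ?n = "s None"
  have poly: "monomial (cat_prob (h *\<^sub>R axis i 1 + x)) (add_draw (Some i) (add_draw None s))
     = (?b - h) ^ Suc ?n * ((?a + h) ^ Suc ?m * R)" for h
  proof -
    have "(\<Prod>c\<in>UNIV - {None} - {Some i}. cat_prob (h *\<^sub>R axis i 1 + x) c ^ add_draw (Some i) (add_draw None s) c) = R"
      unfolding R_def by (rule prod.cong) (auto simp: cat_prob_shift add_draw_def)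
    then show ?thesis unfolding split by (simp add: cat_prob_shift add_draw_def)
  qed
  have R: "(\<Prod>c\<in>UNIV - {None} - {Some i}. cat_prob x c ^ add_draw d s c) = R" if "d = None \<or> d = Some i" for d
    unfolding R_def by (rule prod.cong) (use that in \<open>auto simp: add_draw_def\<close>)
  have D: "((\<lambda>h. (?b - h) ^ Suc ?n * ((?a + h) ^ Suc ?m * R)) has_real_derivative
    real (Suc ?m) * monomial (cat_prob x) (add_draw None s)
    - real (Suc ?n) * monomial (cat_prob x) (add_draw (Some i) s)) (at 0)"
    unfolding split R[OF disjI1[OF refl]] R[OF disjI2[OF refl]]
    by (rule derivative_eq_intros refl)+ (simp add: add_draw_def algebra_simps)
  have tend: "((\<lambda>h. h *\<^sub>R axis i 1 + x) \<longlongrightarrow> x) (at (0::real))"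
    by (auto intro!: tendsto_eq_intros)
  then have "\<forall>\<^sub>F h in at (0::real). h *\<^sub>R axis i 1 + x \<in> Theta"
    using open_Theta x by (rule topological_tendstoD)
  then have ev: "\<forall>\<^sub>F h in at (0::real). (?b - h) ^ Suc ?n * ((?a + h) ^ Suc ?m * R) = simplex_bump i s (h *\<^sub>R axis i 1 + x)"
    by eventually_elim (simp only: simplex_bump_def poly, simp)
  show ?thesis
    using D
  proof (rule DERIV_cong_ev[THEN iffD1, rotated -1])
    show "\<forall>\<^sub>F h in nhds 0. (?b - h) ^ Suc ?n * ((?a + h) ^ Suc ?m * R) = simplex_bump i s (h *\<^sub>R axis i 1 + x)"
      unfolding eventually_nhds_conv_at using ev x poly[of 0] by (simp add: simplex_bump_def)
  qed auto
qed

text \<open>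
  Integration by parts in direction \<open>i\<close>, without iterated integrals.  By translation invariance the
  difference quotients of \<open>simplex_bump\<close> in direction \<open>i\<close> have integral zero.  They are bounded by
  the Lipschitz constant and converge off the boundary of the simplex, which is null because the
  simplex is convex; so the partial derivative has integral zero, which is the claimed identity.
\<close>

lemma dirichlet_integral_exchange:
  fixes s :: "'k::finite option \<Rightarrow> nat"
  shows "real (Suc (s None)) * dirichlet_integral (add_draw (Some i) s)
       = real (Suc (s (Some i))) * dirichlet_integral (add_draw None s)"
proof -
  define F where "F = (simplex_bump i s :: real^'k \<Rightarrow> real)"
  define v :: "real^'k" where "v = axis i 1"
  define h where "h n = 1 / real (Suc n)" for n
  define G where "G x = indicator Theta x * (real (Suc (s (Some i))) * monomial (cat_prob x) (add_draw None s)
    - real (Suc (s None)) * monomial (cat_prob x) (add_draw (Some i) s))" for x :: "real^'k"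
  have h: "0 < h n" "h n \<le> 1" for n by (auto simp: h_def)
  have h0: "h \<longlonglongrightarrow> 0" unfolding h_def using LIMSEQ_inverse_real_of_nat by (simp add: inverse_eq_divide)
  have Fm [measurable]: "F \<in> borel_measurable borel"
    unfolding F_def simplex_bump_def by measurable
  have Gm [measurable]: "G \<in> borel_measurable borel"
    unfolding G_def by measurable
  have F_int: "integrable lborel F"
  proof (rule integrableI_bounded_set[where A = "cbox 0 1" and B = 1])
    have "norm (F x) \<le> 1" for x
      using monomial_bounds[of x "add_draw (Some i) (add_draw None s)"]
      by (cases "x \<in> Theta") (simp_all add: F_def simplex_bump_def)
    then show "AE x in lborel. x \<in> cbox 0 1 \<longrightarrow> norm (F x) \<le> 1" by simp
    show "AE x in lborel. x \<notin> cbox 0 1 \<longrightarrow> F x = 0"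
      unfolding F_def simplex_bump_def using Theta_subset_cbox by (intro AE_I2) (auto simp: indicator_def)
    show "emeasure lborel (cbox 0 (1::real^'k)) < \<infinity>" by (simp add: emeasure_lborel_cbox_eq)
  qed auto
  have zero: "(LINT x|lborel. (F (h n *\<^sub>R v + x) - F x) / h n) = 0" for n
    using lborel_integral_difference_zero[OF F_int, of "h n *\<^sub>R v"] by simp
  have "(\<lambda>n. LINT x|lborel. (F (h n *\<^sub>R v + x) - F x) / h n) \<longlonglongrightarrow> (LINT x|lborel. G x)"
  \<comment> \<open>The box contains every point that a shift by \<open>h n *\<^sub>R v\<close>, of length at most one, moves into the simplex.\<close>
  proof (rule integral_dominated_convergence[where w = "\<lambda>x. indicator (cbox (-1) 1) x * real (sum s UNIV + 2)"])
    show "integrable lborel (\<lambda>x. indicator (cbox (-1) (1::real^'k)) x * real (sum s UNIV + 2))"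
      by (intro integrable_mult_left integrable_real_indicator) (auto simp: emeasure_lborel_cbox_eq)
    show "AE x in lborel. (\<lambda>n. (F (h n *\<^sub>R v + x) - F x) / h n) \<longlonglongrightarrow> G x"
      using AE_not_frontier_Theta
    proof eventually_elim
      case (elim x)
      show ?case
      proof (cases "x \<in> Theta")
        case True
        from simplex_bump_derivative[OF True, of i s]
        have "((\<lambda>t. (F (t *\<^sub>R v + x) - F x) / t) \<longlongrightarrow> G x) (at 0)"
          using True by (simp add: has_field_derivative_iff F_def G_def v_def)
        moreover have "filterlim h (at 0) sequentially"
          unfolding filterlim_at using h0 h(1) by (auto intro!: always_eventually simp: less_imp_neq[symmetric])
        ultimately show ?thesis by (rule filterlim_compose)
      next
        case False
        with elim have "x \<in> - closure Theta" using closure_Un_frontier[of Theta] by auto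
        moreover have "(\<lambda>n. h n *\<^sub>R v + x) \<longlonglongrightarrow> x"
          using h0 by (auto intro!: tendsto_eq_intros)
        ultimately have "\<forall>\<^sub>F n in sequentially. h n *\<^sub>R v + x \<in> - closure Theta"
          by (intro topological_tendstoD) auto
        then have "\<forall>\<^sub>F n in sequentially. (F (h n *\<^sub>R v + x) - F x) / h n = G x"
        proof eventually_elim
          case (elim n)
          then have "h n *\<^sub>R v + x \<notin> Theta" using closure_subset by auto
          then show ?case using False by (simp add: F_def G_def simplex_bump_def)
        qed
        then show ?thesis by (rule tendsto_eventually)
      qed
    qed
    show "AE x in lborel. norm ((F (h n *\<^sub>R v + x) - F x) / h n) \<le> indicator (cbox (-1) 1) x * real (sum s UNIV + 2)" for n
    proof (rule AE_I2)
      fix x :: "real^'k"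
      have "\<bar>F (h n *\<^sub>R v + x) - F x\<bar> \<le> real (sum s UNIV + 2) * h n"
        unfolding F_def v_def using h(1)[of n] by (intro simplex_bump_lipschitz) simp
      then have lip: "norm ((F (h n *\<^sub>R v + x) - F x) / h n) \<le> real (sum s UNIV + 2)"
        using h(1)[of n] by (simp add: field_simps)
      show "norm ((F (h n *\<^sub>R v + x) - F x) / h n) \<le> indicator (cbox (-1) 1) x * real (sum s UNIV + 2)"
      proof (cases "x \<in> cbox (-1) 1")
        case False
        have "x \<in> cbox (-1) 1" if "x + t *\<^sub>R v \<in> Theta" "0 \<le> t" "t \<le> 1" for t
        proof -
          have "0 \<le> (x + t *\<^sub>R v) $ j \<and> (x + t *\<^sub>R v) $ j \<le> 1" for j
            using that(1) Theta_subset_cbox by (auto simp: mem_box_cart)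
          then have "0 \<le> x $ j + t * v $ j \<and> x $ j + t * v $ j \<le> 1" for j by simp
          moreover have "0 \<le> t * v $ j \<and> t * v $ j \<le> 1" for j
            using that(2,3) by (auto simp: v_def axis_def)
          ultimately show ?thesis unfolding mem_box_cart
            by (smt (verit) one_index vector_uminus_component)
        qed
        from this[of 0] this[of "h n"] False h[of n]
        have "x \<notin> Theta" "h n *\<^sub>R v + x \<notin> Theta" by (auto simp: add.commute less_imp_le)
        then have "norm ((F (h n *\<^sub>R v + x) - F x) / h n) = 0" by (simp add: F_def simplex_bump_def)
        then show ?thesis by (metis indicator_pos_le mult_nonneg_nonneg of_nat_0_le_iff)
      qed (use lip in simp)
    qed
  qed measurable
  then have "(LINT x|lborel. G x) = 0" unfolding zero by (simp add: LIMSEQ_const_iff)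
  also have "(LINT x|lborel. G x) = (LINT x|lebesgue_on Theta.
      real (Suc (s (Some i))) * monomial (cat_prob x) (add_draw None s)
      - real (Suc (s None)) * monomial (cat_prob x) (add_draw (Some i) s))"
    unfolding G_def by (rule lebesgue_on_Theta_integral[symmetric]) measurable
  also have "\<dots> = real (Suc (s (Some i))) * dirichlet_integral (add_draw None s)
      - real (Suc (s None)) * dirichlet_integral (add_draw (Some i) s)"
    unfolding dirichlet_integral_def
    by (subst Bochner_Integration.integral_diff)
       (auto intro!: integrable_mult_right integrable_monomial simp del: of_nat_Suc)
  finally show ?thesis by simp
qed

text \<open>
  By the exchange identity the integral with one more draw of \<open>d\<close>, divided by \<open>s\<^sub>d + 1\<close>, is the same
  for every category \<open>d\<close>.  As the coordinates add up to \<open>1\<close>, these integrals add up to that of \<open>s\<close>,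
  which determines the common value.
\<close>

lemma dirichlet_integral_add_draw:
  fixes s :: "'k::finite option \<Rightarrow> nat"
  shows "real (sum s UNIV + CARD('k option)) * dirichlet_integral (add_draw c s)
       = real (Suc (s c)) * dirichlet_integral s"
proof -
  define q where "q = dirichlet_integral (add_draw None s) / real (Suc (s None))"
  have q: "dirichlet_integral (add_draw d s) = real (Suc (s d)) * q" for d
  proof (cases d)
    case (Some i)
    then show ?thesis using dirichlet_integral_exchange[of s i]
      by (simp add: q_def field_simps del: of_nat_Suc)
  qed (simp add: q_def del: of_nat_Suc)
  have "dirichlet_integral s = (LINT \<theta>|lebesgue_on Theta. (\<Sum>d\<in>UNIV. monomial (cat_prob \<theta>) (add_draw d s)))"
    unfolding dirichlet_integral_def monomial_add_draw
    by (simp add: sum_cat_prob flip: sum_distrib_right)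
  also have "\<dots> = (\<Sum>d\<in>UNIV. dirichlet_integral (add_draw d s))"
    unfolding dirichlet_integral_def by (rule Bochner_Integration.integral_sum) (rule integrable_monomial)
  also have "\<dots> = real (sum s UNIV + CARD('k option)) * q"
    unfolding q by (simp add: sum.distrib ring_distribs sum_distrib_right)
  finally show ?thesis unfolding q by simp
qed

lemma dirichlet_integral_0_pos: "0 < dirichlet_integral (\<lambda>_::'k::finite option. 0)"
proof -
  have "(Theta :: (real^'k) set) \<noteq> {}"
  proof -
    have "(\<chi> i. 1 / real (Suc CARD('k))) \<in> (Theta :: (real^'k) set)"
      by (simp add: Theta_def)
    then show ?thesis by blast
  qed
  then have "0 < measure lebesgue (Theta :: (real^'k) set)"
    using open_Theta open_not_negligible negligible_iff_measure0[OF Theta_lmeasurable] zero_less_measure_iff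
    by blast
  then show ?thesis
    by (simp add: dirichlet_integral_def monomial_def measure_restrict_space Theta_lmeasurable_set)
qed

text \<open>
  Dirichlet's formula, by removing one draw at a time; the integral for zero counts is the volume of
  the simplex.
\<close>

lemma dirichlet_integral_eq:
  fixes s :: "'k::finite option \<Rightarrow> nat"
  shows "fact (sum s UNIV + CARD('k)) * dirichlet_integral s
       = fact CARD('k) * (\<Prod>c\<in>UNIV. fact (s c)) * dirichlet_integral (\<lambda>_::'k option. 0)"
proof (induction "sum s UNIV" arbitrary: s)
  case 0
  then have "s = (\<lambda>_. 0)" by auto
  then show ?case by simp
next
  case (Suc n)
  obtain c where c: "s c \<noteq> 0"
  proof (rule ccontr)
    assume "\<not> thesis"
    with that have "sum s UNIV = 0" by (intro sum.neutral) blast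
    with Suc(2) show False by simp
  qed
  define r where "r = s(c := s c - 1)"
  have s: "s = add_draw c r" using c by (auto simp: r_def add_draw_def)
  have n: "sum r UNIV = n" using Suc(2) unfolding s sum_add_draw by simp
  have "fact (sum s UNIV + CARD('k)) * dirichlet_integral s
      = fact (n + CARD('k)) * (real (sum r UNIV + CARD('k option)) * dirichlet_integral (add_draw c r))"
    unfolding s sum_add_draw n by (simp add: card_UNIV_option algebra_simps)
  also have "\<dots> = real (Suc (r c)) * (fact (sum r UNIV + CARD('k)) * dirichlet_integral r)"
    unfolding dirichlet_integral_add_draw unfolding n by simp
  also have "\<dots> = fact CARD('k) * (\<Prod>c\<in>UNIV. fact (s c)) * dirichlet_integral (\<lambda>_::'k option. 0)"
    unfolding Suc(1)[OF n[symmetric]] unfolding s fact_prod_add_draw by (simp add: mult_ac)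
  finally show ?case .
qed

section \<open>Dirichlet means near continuity points\<close>

lemma dirichlet_integral_pos: "0 < dirichlet_integral (s :: 'k::finite option \<Rightarrow> nat)"
proof -
  have "0 < fact CARD('k) * (\<Prod>c\<in>UNIV. fact (s c)) * dirichlet_integral (\<lambda>_::'k option. 0)"
    by (intro mult_pos_pos prod_pos dirichlet_integral_0_pos) auto
  then have "0 < fact (sum s UNIV + CARD('k)) * dirichlet_integral s"
    unfolding dirichlet_integral_eq .
  then show ?thesis by (simp add: zero_less_mult_iff)
qed

text \<open>
  The posterior mean of \<open>f\<close> under a uniform prior after observing counts \<open>s\<close>, in other words the mean
  under the Dirichlet distribution with parameters \<open>s\<^sub>c + 1\<close>.
\<close>

definition dirichlet_mean :: "(real^'k::finite \<Rightarrow> real) \<Rightarrow> ('k option \<Rightarrow> nat) \<Rightarrow> real" where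
  "dirichlet_mean f s = (LINT \<theta>|lebesgue_on Theta. monomial (cat_prob \<theta>) s * f \<theta>) / dirichlet_integral s"

lemma integrable_monomial_mult:
  fixes f :: "real^'k::finite \<Rightarrow> real"
  assumes "integrable (lebesgue_on Theta) f"
  shows "integrable (lebesgue_on Theta) (\<lambda>\<theta>. monomial (cat_prob \<theta>) s * f \<theta>)"
proof (rule Bochner_Integration.integrable_bound[OF assms])
  show "(\<lambda>\<theta>. monomial (cat_prob \<theta>) s * f \<theta>) \<in> borel_measurable (lebesgue_on Theta)"
    using assms borel_measurable_on_Theta[OF monomial_measurable] by (intro borel_measurable_times) auto
  show "AE \<theta> in lebesgue_on Theta. norm (monomial (cat_prob \<theta>) s * f \<theta>) \<le> norm (f \<theta>)"
  proof (rule AE_I2)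
    fix \<theta> :: "real^'k" assume "\<theta> \<in> space (lebesgue_on Theta)"
    then show "norm (monomial (cat_prob \<theta>) s * f \<theta>) \<le> norm (f \<theta>)"
      using monomial_bounds[of \<theta> s] by (auto simp: abs_mult intro: mult_left_le_one_le)
  qed
qed

lemma dirichlet_mean_add:
  assumes "integrable (lebesgue_on Theta) f" "integrable (lebesgue_on Theta) g"
  shows "dirichlet_mean (\<lambda>\<theta>. f \<theta> + g \<theta>) s = dirichlet_mean f s + dirichlet_mean g s"
  unfolding dirichlet_mean_def distrib_left
  by (subst Bochner_Integration.integral_add) (auto intro: integrable_monomial_mult assms simp: add_divide_distrib)

lemma dirichlet_mean_cmult: "dirichlet_mean (\<lambda>\<theta>. a * f \<theta>) s = a * dirichlet_mean f s"
  by (simp add: dirichlet_mean_def mult.left_commute)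

lemma dirichlet_mean_sum:
  assumes "\<And>i. i \<in> I \<Longrightarrow> integrable (lebesgue_on Theta) (f i)"
  shows "dirichlet_mean (\<lambda>\<theta>. \<Sum>i\<in>I. f i \<theta>) s = (\<Sum>i\<in>I. dirichlet_mean (f i) s)"
  unfolding dirichlet_mean_def sum_distrib_left
  by (subst Bochner_Integration.integral_sum) (auto intro: integrable_monomial_mult assms simp: sum_divide_distrib)

lemma dirichlet_mean_const: "dirichlet_mean (\<lambda>_. a) s = a"
  using dirichlet_integral_pos[of s] by (simp add: dirichlet_mean_def dirichlet_integral_def)

lemma dirichlet_mean_mono:
  assumes "integrable (lebesgue_on Theta) f" "integrable (lebesgue_on Theta) g"
    and "\<And>\<theta>. \<theta> \<in> Theta \<Longrightarrow> f \<theta> \<le> g \<theta>"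
  shows "dirichlet_mean f s \<le> dirichlet_mean g s"
  unfolding dirichlet_mean_def
  by (intro divide_right_mono integral_mono integrable_monomial_mult assms mult_left_mono)
     (auto intro: less_imp_le monomial_bounds dirichlet_integral_pos)

lemma integrable_continuous_on_Theta:
  fixes f :: "real^'k::finite \<Rightarrow> real"
  assumes "continuous_on UNIV f"
  shows "integrable (lebesgue_on Theta) f"
proof -
  have "compact (f ` cbox 0 1)"
    using assms by (intro compact_continuous_image compact_cbox) (auto intro: continuous_on_subset)
  then obtain C where C: "\<And>x. x \<in> cbox 0 1 \<Longrightarrow> norm (f x) \<le> C"
    using compact_imp_bounded by (metis bounded_iff imageI)
  show ?thesis
    by (rule integrable_on_Theta[where C = C])
       (use C Theta_subset_cbox assms in \<open>auto intro!: borel_measurable_on_Theta borel_measurable_continuous_onI\<close>)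
qed

text \<open>
  A factor \<open>\<theta>\<^sub>c\<close> raises the exponent of category \<open>c\<close>, so it can be absorbed into the Dirichlet
  density at the price of the ratio of the two normalising constants.
\<close>

lemma dirichlet_mean_size_bias:
  fixes f :: "real^'k::finite \<Rightarrow> real"
  shows "dirichlet_mean (\<lambda>\<theta>. cat_prob \<theta> c * f \<theta>) s
    = real (Suc (s c)) / real (sum s UNIV + CARD('k option)) * dirichlet_mean f (add_draw c s)"
proof -
  have "dirichlet_mean (\<lambda>\<theta>. cat_prob \<theta> c * f \<theta>) s
      = dirichlet_integral (add_draw c s) / dirichlet_integral s * dirichlet_mean f (add_draw c s)"
    using dirichlet_integral_pos[of "add_draw c s"]
    unfolding dirichlet_mean_def monomial_add_draw by (simp add: mult_ac)
  also have "dirichlet_integral (add_draw c s) / dirichlet_integral s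
      = real (Suc (s c)) / real (sum s UNIV + CARD('k option))"
    using dirichlet_integral_add_draw[of s c] dirichlet_integral_pos[of s]
    by (simp add: frac_eq_eq mult.commute del: of_nat_add of_nat_Suc)
  finally show ?thesis .
qed

text \<open>
  Variance plus squared bias: applying the size-bias identity once and twice gives the mean \<open>a/A\<close> and
  the second moment \<open>a(a + 1)/(A(A + 1))\<close> with \<open>a = s\<^sub>c + 1\<close>, and the variance
  \<open>(a/A)(1 - a/A)/(A + 1)\<close> is at most \<open>1/A\<close>.
\<close>

lemma dirichlet_mean_square_deviation:
  fixes s :: "'k::finite option \<Rightarrow> nat" and c q
  defines "A \<equiv> real (sum s UNIV + CARD('k option))"
  shows "dirichlet_mean (\<lambda>\<theta>. (cat_prob \<theta> c - q)\<^sup>2) s \<le> 1 / A + (real (Suc (s c)) / A - q)\<^sup>2"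
proof -
  define a where "a = real (Suc (s c))"
  have A: "A > 0" by (simp add: A_def add_nonneg_pos sum_nonneg)
  have a: "0 \<le> a" "a \<le> A"
  proof -
    have "s c \<le> sum s UNIV" by (rule member_le_sum) auto
    moreover have "0 < CARD('k option)" by simp
    ultimately have "Suc (s c) \<le> sum s UNIV + CARD('k option)" by linarith
    then show "a \<le> A" unfolding a_def A_def of_nat_le_iff .
  qed (simp add: a_def)
  note int = integrable_continuous_on_Theta
  have first: "dirichlet_mean (\<lambda>\<theta>. cat_prob \<theta> c) s = a / A"
    using dirichlet_mean_size_bias[of c "\<lambda>_. 1" s] by (simp add: dirichlet_mean_const a_def A_def)
  have "dirichlet_mean (\<lambda>\<theta>. cat_prob \<theta> c) (add_draw c s) = (a + 1) / (A + 1)"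
    using dirichlet_mean_size_bias[of c "\<lambda>_. 1" "add_draw c s"]
    unfolding dirichlet_mean_const sum_add_draw
    by (simp add: a_def A_def add_draw_def add_ac)
  then have second: "dirichlet_mean (\<lambda>\<theta>. cat_prob \<theta> c * cat_prob \<theta> c) s = a / A * ((a + 1) / (A + 1))"
    using dirichlet_mean_size_bias[of c "\<lambda>\<theta>. cat_prob \<theta> c" s] by (simp add: a_def A_def)
  have "dirichlet_mean (\<lambda>\<theta>. (cat_prob \<theta> c - q)\<^sup>2) s
      = dirichlet_mean (\<lambda>\<theta>. cat_prob \<theta> c * cat_prob \<theta> c + ((- 2 * q) * cat_prob \<theta> c + q\<^sup>2)) s"
    by (intro arg_cong[where f = "\<lambda>f. dirichlet_mean f s"] ext) (simp add: power2_eq_square algebra_simps)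
  also have "\<dots> = a / A * ((a + 1) / (A + 1)) + ((- 2 * q) * (a / A) + q\<^sup>2)"
    by (subst dirichlet_mean_add, (intro int continuous_intros)+,
        subst dirichlet_mean_add, (intro int continuous_intros)+)
       (simp only: dirichlet_mean_cmult dirichlet_mean_const first second)
  also have "(a + 1) / (A + 1) = (1 - a / A) * (1 / (A + 1)) + a / A"
  proof -
    have "a + 1 = (1 - a / A) + a / A * (A + 1)" using A by (simp add: distrib_left)
    then have "(a + 1) / (A + 1) = ((1 - a / A) + a / A * (A + 1)) / (A + 1)" by simp
    also have "\<dots> = (1 - a / A) * (1 / (A + 1)) + a / A"
      using A unfolding add_divide_distrib by simp
    finally show ?thesis .
  qed
  also have "a / A * ((1 - a / A) * (1 / (A + 1)) + a / A) + (- 2 * q * (a / A) + q\<^sup>2)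
      = (a / A) * (1 - a / A) * (1 / (A + 1)) + (a / A - q)\<^sup>2"
  proof -
    have "x * ((1 - x) * e + x) + (- 2 * q * x + q\<^sup>2) = x * (1 - x) * e + (x - q)\<^sup>2" for x e :: real
      by (simp add: algebra_simps power2_eq_square)
    then show ?thesis .
  qed
  also have "(a / A) * (1 - a / A) * (1 / (A + 1)) \<le> 1 * 1 * (1 / A)"
    by (intro mult_mono divide_left_mono) (use A a in auto)
  finally show ?thesis by (simp add: a_def)
qed

text \<open>
  Within distance \<open>r\<close> of \<open>p\<close> continuity controls \<open>\<bar>\<pi> \<theta> - \<pi> p\<bar>\<close>, and outside the bound \<open>B\<close> is
  dominated by \<open>B/r\<^sup>2\<close> times the squared distance.  The Dirichlet mean of this quadratic majorant is
  small uniformly in all \<open>s\<close> with frequencies near \<open>p\<close>.  Uniformity matters: it serves both the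
  observed counts and the random counts of the prior predictive measure.
\<close>

lemma dirichlet_mean_near:
  fixes \<pi> :: "real^'k::finite \<Rightarrow> real"
  assumes meas: "\<pi> \<in> borel_measurable (lebesgue_on Theta)"
    and bnd: "\<And>\<theta>. \<theta> \<in> Theta \<Longrightarrow> 0 \<le> \<pi> \<theta> \<and> \<pi> \<theta> \<le> B"
    and p: "p \<in> Theta_c \<pi>" and \<epsilon>: "\<epsilon> > 0"
  obtains \<delta> where "\<delta> > 0"
    "\<forall>\<^sub>F n in sequentially. \<forall>s\<in>weak_compositions n.
       (\<forall>c. \<bar>real (s c) / real n - cat_prob p c\<bar> < \<delta>) \<longrightarrow> \<bar>dirichlet_mean \<pi> s - \<pi> p\<bar> < \<epsilon>"
proof -
  have pT: "p \<in> Theta" using p by (simp add: Theta_c_def)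
  have B: "0 \<le> B" using bnd[OF pT] by linarith
  from p have "continuous (at p within Theta) \<pi>" by (simp add: Theta_c_def)
  then obtain r where r: "r > 0" "\<And>\<theta>. \<theta> \<in> Theta \<Longrightarrow> dist \<theta> p < r \<Longrightarrow> \<bar>\<pi> \<theta> - \<pi> p\<bar> < \<epsilon> / 2"
    unfolding continuous_within_eps_delta using \<epsilon> by (auto simp: dist_real_def dest!: spec[of _ "\<epsilon> / 2"])
  define K where "K = real CARD('k option)"
  have K: "K \<ge> 1" unfolding K_def by (simp add: Suc_leI)
  define dev where "dev \<theta> = (\<Sum>c\<in>UNIV. (cat_prob \<theta> c - cat_prob p c)\<^sup>2)" for \<theta>
  have pointwise: "\<bar>\<pi> \<theta> - \<pi> p\<bar> \<le> \<epsilon> / 2 + B / r\<^sup>2 * dev \<theta>" if \<theta>: "\<theta> \<in> Theta" for \<theta>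
  proof (cases "dist \<theta> p < r")
    case True
    have "0 \<le> B / r\<^sup>2 * dev \<theta>" unfolding dev_def using B by (intro mult_nonneg_nonneg sum_nonneg) auto
    with r(2)[OF \<theta> True] show ?thesis by linarith
  next
    case False
    have "r\<^sup>2 \<le> (dist \<theta> p)\<^sup>2" using False r(1) by (intro power_mono) auto
    also have "\<dots> = (\<Sum>i\<in>UNIV. (\<theta> $ i - p $ i)\<^sup>2)"
      by (simp add: dist_vec_def L2_set_def dist_real_def sum_nonneg)
    also have "\<dots> \<le> dev \<theta>"
      by (simp add: dev_def UNIV_option_conv sum.reindex cat_prob_def)
    finally have "1 \<le> dev \<theta> / r\<^sup>2" using r(1) by simp
    then have "B * 1 \<le> B * (dev \<theta> / r\<^sup>2)" using B by (intro mult_left_mono)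
    moreover have "\<bar>\<pi> \<theta> - \<pi> p\<bar> \<le> B" using bnd[OF \<theta>] bnd[OF pT] by linarith
    ultimately show ?thesis using \<epsilon> by simp
  qed
  \<comment> \<open>The tolerance \<open>\<eta>\<close> also bounds \<open>K/n\<close>: the bias is then at most \<open>2\<eta>\<close> and the variance at most \<open>\<eta>\<close>.\<close>
  have "((\<lambda>\<eta>. B / r\<^sup>2 * (K * (\<eta> + (2 * \<eta>)\<^sup>2))) \<longlongrightarrow> B / r\<^sup>2 * (K * (0 + (2 * 0)\<^sup>2))) (at_right 0)"
    by (intro tendsto_intros)
  then have "\<forall>\<^sub>F \<eta> in at_right 0. B / r\<^sup>2 * (K * (\<eta> + (2 * \<eta>)\<^sup>2)) < \<epsilon> / 2"
    using \<epsilon> by (intro order_tendstoD(2)) auto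
  then have "\<forall>\<^sub>F \<eta> in at_right 0. 0 < \<eta> \<and> B / r\<^sup>2 * (K * (\<eta> + (2 * \<eta>)\<^sup>2)) < \<epsilon> / 2"
    using eventually_at_right_less[of "0::real"] by eventually_elim auto
  then obtain \<eta> where \<eta>: "0 < \<eta>" "B / r\<^sup>2 * (K * (\<eta> + (2 * \<eta>)\<^sup>2)) < \<epsilon> / 2"
    using eventually_happens trivial_limit_at_right_real by blast
  have pi_int: "integrable (lebesgue_on Theta) \<pi>"
    by (rule integrable_on_Theta[OF meas, of B]) (use bnd in auto)
  have devc: "continuous_on UNIV dev" unfolding dev_def by (intro continuous_intros)
  have quadratic_int: "integrable (lebesgue_on Theta) (\<lambda>\<theta>. a + b * dev \<theta>)" for a b
    by (intro integrable_continuous_on_Theta continuous_intros devc)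
  have quadratic_mean: "dirichlet_mean (\<lambda>\<theta>. a + b * dev \<theta>) s = a + b * dirichlet_mean dev s" for a b s
    by (subst dirichlet_mean_add, (intro integrable_continuous_on_Theta continuous_intros devc)+)
       (simp only: dirichlet_mean_cmult dirichlet_mean_const)
  have main: "\<bar>dirichlet_mean \<pi> s - \<pi> p\<bar> < \<epsilon>"
    if n: "n > 0" "K / real n \<le> \<eta>" and s: "s \<in> weak_compositions n"
      and near: "\<And>c. \<bar>real (s c) / real n - cat_prob p c\<bar> < \<eta>" for n s
  proof -
    have sn: "sum s UNIV = n" using s by (simp add: weak_compositions_def)
    have summand: "dirichlet_mean (\<lambda>\<theta>. (cat_prob \<theta> c - cat_prob p c)\<^sup>2) s \<le> \<eta> + (2 * \<eta>)\<^sup>2" for c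
    proof -
      have sc: "s c \<le> n" unfolding sn[symmetric] by (rule member_le_sum) auto
      let ?A = "real n + K"
      \<comment> \<open>The Dirichlet mean differs from the frequency by at most \<open>K/n\<close>.\<close>
      have diff: "real (Suc (s c)) / ?A - real (s c) / real n = (real n - real (s c) * K) / (real n * ?A)"
        using n K by (simp add: field_simps)
      have "\<bar>real n - real (s c) * K\<bar> \<le> real n * K"
      proof -
        have "real (s c) * K \<le> real n * K" "real n * 1 \<le> real n * K"
          using sc K by (intro mult_right_mono mult_left_mono; simp)+
        moreover have "0 \<le> real (s c) * K" using K by simp
        ultimately show ?thesis by linarith
      qed
      moreover have nonneg: "0 \<le> real n * ?A" using K by simp
      ultimately have "\<bar>real (Suc (s c)) / ?A - real (s c) / real n\<bar> \<le> real n * K / (real n * ?A)"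
        unfolding diff abs_divide abs_of_nonneg[OF nonneg] by (intro divide_right_mono)
      also have "\<dots> = K / ?A" using n by simp
      also have "\<dots> \<le> K / real n" using n K by (intro divide_left_mono) auto
      finally have "\<bar>real (Suc (s c)) / ?A - cat_prob p c\<bar> \<le> 2 * \<eta>" using n(2) near[of c] by linarith
      then have "(real (Suc (s c)) / ?A - cat_prob p c)\<^sup>2 \<le> (2 * \<eta>)\<^sup>2"
        by (rule power2_le_iff_abs_le[THEN iffD2, rotated]) (use \<eta> in simp)
      moreover have "1 / ?A \<le> K / real n" using n K by (intro frac_le) auto
      moreover have "dirichlet_mean (\<lambda>\<theta>. (cat_prob \<theta> c - cat_prob p c)\<^sup>2) s
          \<le> 1 / ?A + (real (Suc (s c)) / ?A - cat_prob p c)\<^sup>2"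
        using dirichlet_mean_square_deviation[of c "cat_prob p c" s] unfolding sn of_nat_add K_def .
      ultimately show ?thesis using n(2) by linarith
    qed
    have "dirichlet_mean dev s = (\<Sum>c\<in>UNIV. dirichlet_mean (\<lambda>\<theta>. (cat_prob \<theta> c - cat_prob p c)\<^sup>2) s)"
      unfolding dev_def by (rule dirichlet_mean_sum) (intro integrable_continuous_on_Theta continuous_intros)
    also have "\<dots> \<le> (\<Sum>c\<in>(UNIV::'k option set). \<eta> + (2 * \<eta>)\<^sup>2)"
      by (intro sum_mono summand)
    also have "\<dots> = K * (\<eta> + (2 * \<eta>)\<^sup>2)"
      by (simp add: K_def)
    finally have "B / r\<^sup>2 * dirichlet_mean dev s \<le> B / r\<^sup>2 * (K * (\<eta> + (2 * \<eta>)\<^sup>2))"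
      using B by (intro mult_left_mono) auto
    with \<eta>(2) have small: "\<epsilon> / 2 + B / r\<^sup>2 * dirichlet_mean dev s < \<epsilon>" by linarith
    have "dirichlet_mean \<pi> s \<le> dirichlet_mean (\<lambda>\<theta>. (\<pi> p + \<epsilon> / 2) + B / r\<^sup>2 * dev \<theta>) s"
    proof (rule dirichlet_mean_mono[OF pi_int quadratic_int])
      fix \<theta> :: "real^'k" assume "\<theta> \<in> Theta"
      from pointwise[OF this] show "\<pi> \<theta> \<le> (\<pi> p + \<epsilon> / 2) + B / r\<^sup>2 * dev \<theta>" by linarith
    qed
    also have "\<dots> = \<pi> p + (\<epsilon> / 2 + B / r\<^sup>2 * dirichlet_mean dev s)"
      unfolding quadratic_mean by simp
    finally have upper: "dirichlet_mean \<pi> s < \<pi> p + \<epsilon>" using small by linarith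
    have "\<pi> p + - (\<epsilon> / 2 + B / r\<^sup>2 * dirichlet_mean dev s)
        = dirichlet_mean (\<lambda>\<theta>. (\<pi> p - \<epsilon> / 2) + (- (B / r\<^sup>2)) * dev \<theta>) s"
      unfolding quadratic_mean by simp
    also have "\<dots> \<le> dirichlet_mean \<pi> s"
    proof (rule dirichlet_mean_mono[OF quadratic_int pi_int])
      fix \<theta> :: "real^'k" assume "\<theta> \<in> Theta"
      from pointwise[OF this] show "(\<pi> p - \<epsilon> / 2) + (- (B / r\<^sup>2)) * dev \<theta> \<le> \<pi> \<theta>"
        unfolding mult_minus_left by linarith
    qed
    finally show ?thesis using upper small by linarith
  qed
  have "(\<lambda>n. K / real n) \<longlonglongrightarrow> 0" by (rule lim_const_over_n)
  then have "\<forall>\<^sub>F n in sequentially. K / real n < \<eta>" using \<eta>(1) by (rule order_tendstoD(2))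
  then have "\<forall>\<^sub>F n in sequentially. \<forall>s\<in>weak_compositions n.
       (\<forall>c. \<bar>real (s c) / real n - cat_prob p c\<bar> < \<eta>) \<longrightarrow> \<bar>dirichlet_mean \<pi> s - \<pi> p\<bar> < \<epsilon>"
    using eventually_gt_at_top[of 0] by eventually_elim (use main in auto)
  with \<eta>(1) show ?thesis by (rule that)
qed

section \<open>The strong law for category frequencies\<close>

text \<open>
  Hoeffding's inequality makes the deviation probabilities of the frequency decay geometrically in
  \<open>n\<close>, so Borel-Cantelli applies for every tolerance; countably many tolerances suffice.
\<close>

lemma (in prob_space) strong_law_frequency:
  fixes X :: "nat \<Rightarrow> 'a \<Rightarrow> 'c"
  assumes indep: "indep_vars (\<lambda>_. count_space UNIV) X UNIV"
    and prob_c: "\<And>i. prob {\<omega>\<in>space M. X i \<omega> = c} = q"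
  shows "AE \<omega> in M. (\<lambda>n. real (card {j. j < n \<and> X j \<omega> = c}) / real n) \<longlonglongrightarrow> q"
proof -
  define Y :: "nat \<Rightarrow> 'a \<Rightarrow> real" where "Y j \<omega> = indicator {c} (X j \<omega>)" for j \<omega>
  have indepY: "indep_vars (\<lambda>_. borel) Y UNIV"
    unfolding Y_def by (rule indep_vars_compose2[OF indep]) simp
  have Xm [measurable]: "X j \<in> measurable M (count_space UNIV)" for j
    using indep unfolding indep_vars_def by auto
  have EY: "expectation (Y j) = q" for j
  proof -
    have "expectation (Y j) = expectation (indicator {\<omega>\<in>space M. X j \<omega> = c})"
      unfolding Y_def by (intro Bochner_Integration.integral_cong) (auto simp: indicator_def)
    also have "\<dots> = q" using prob_c[of j] by simp
    finally show ?thesis .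
  qed
  have count: "real (card {j. j < n \<and> X j \<omega> = c}) = (\<Sum>j<n. Y j \<omega>)" for n \<omega>
    unfolding Y_def by (simp add: indicator_def sum.If_cases Collect_conj_eq lessThan_def)
  have hoeffding: "prob {\<omega>\<in>space M. \<bar>(\<Sum>j<n. Y j \<omega>) - real n * q\<bar> \<ge> \<epsilon> * real n} \<le> 2 * exp (- 2 * \<epsilon>\<^sup>2) ^ n"
    if n: "n > 0" and \<epsilon>: "\<epsilon> > 0" for n \<epsilon>
  proof -
    interpret H: Hoeffding_ineq M "{..<n}" Y "\<lambda>_. 0" "\<lambda>_. 1" "\<Sum>j<n. expectation (Y j)"
    proof unfold_locales
      show "indep_vars (\<lambda>_. borel) Y {..<n}" by (rule indep_vars_subset[OF indepY]) auto
    qed (auto simp: Y_def indicator_def)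
    have "prob {\<omega>\<in>space M. \<bar>(\<Sum>j<n. Y j \<omega>) - (\<Sum>j<n. expectation (Y j))\<bar> \<ge> \<epsilon> * real n}
        \<le> 2 * exp (- 2 * (\<epsilon> * real n)\<^sup>2 / (\<Sum>j<n. (1 - 0)\<^sup>2))"
      by (rule H.Hoeffding_ineq_abs_ge) (use n \<epsilon> in auto)
    also have "- 2 * (\<epsilon> * real n)\<^sup>2 / (\<Sum>j<n. (1 - 0)\<^sup>2) = real n * (- 2 * \<epsilon>\<^sup>2)"
      using n by (simp add: power2_eq_square field_simps)
    finally show ?thesis unfolding exp_of_nat_mult by (simp add: EY)
  qed
  have close: "AE \<omega> in M. \<forall>\<^sub>F n in sequentially. \<bar>(\<Sum>j<n. Y j \<omega>) / real n - q\<bar> < \<epsilon>"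
    if \<epsilon>: "\<epsilon> > 0" for \<epsilon>
  proof -
    define A where "A n = {\<omega>\<in>space M. \<bar>(\<Sum>j<n. Y j \<omega>) - real n * q\<bar> \<ge> \<epsilon> * real n}" for n
    have [measurable]: "Y j \<in> borel_measurable M" for j
      using indepY unfolding indep_vars_def by auto
    have A[measurable]: "A n \<in> sets M" for n unfolding A_def by measurable
    have "summable (\<lambda>n. 2 * exp (- 2 * \<epsilon>\<^sup>2) ^ n)"
      using \<epsilon> by (intro summable_mult summable_geometric) auto
    then have "summable (\<lambda>n. prob (A n))"
    proof (rule summable_comparison_test_ev[rotated])
      show "\<forall>\<^sub>F n in sequentially. norm (prob (A n)) \<le> 2 * exp (- 2 * \<epsilon>\<^sup>2) ^ n"
        using eventually_gt_at_top[of 0] by eventually_elim (use hoeffding \<epsilon> in \<open>auto simp: A_def\<close>)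
    qed
    then have "AE \<omega> in M. \<forall>\<^sub>F n in sequentially. \<omega> \<in> space M - A n"
      by (intro borel_cantelli_AE1) (auto simp: emeasure_eq_measure)
    then show ?thesis
    proof eventually_elim
      case (elim \<omega>)
      then show ?case using eventually_gt_at_top[of 0]
      proof eventually_elim
        case (elim n)
        then have "\<bar>(\<Sum>j<n. Y j \<omega>) - real n * q\<bar> < \<epsilon> * real n" by (auto simp: A_def)
        moreover have "(\<Sum>j<n. Y j \<omega>) - real n * q = real n * ((\<Sum>j<n. Y j \<omega>) / real n - q)"
          using elim by (simp add: field_simps)
        ultimately have "real n * \<bar>(\<Sum>j<n. Y j \<omega>) / real n - q\<bar> < real n * \<epsilon>"
          by (simp add: abs_mult mult.commute)
        then show ?case using elim by simp
      qed
    qed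
  qed
  have "AE \<omega> in M. \<forall>m. \<forall>\<^sub>F n in sequentially. \<bar>(\<Sum>j<n. Y j \<omega>) / real n - q\<bar> < inverse (real (Suc m))"
    unfolding AE_all_countable by (intro allI close) auto
  then show ?thesis
  proof eventually_elim
    case (elim \<omega>)
    show ?case unfolding count
    proof (rule tendstoI)
      fix e :: real assume "e > 0"
      then obtain m where m: "inverse (real (Suc m)) < e" using reals_Archimedean by blast
      from elim have "\<forall>\<^sub>F n in sequentially. \<bar>(\<Sum>j<n. Y j \<omega>) / real n - q\<bar> < inverse (real (Suc m))" by blast
      then show "\<forall>\<^sub>F n in sequentially. dist ((\<Sum>j<n. Y j \<omega>) / real n) q < e"
        by eventually_elim (use m in \<open>auto simp: dist_real_def\<close>)
    qed
  qed
qed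

section \<open>Prior predictive probabilities as Dirichlet means\<close>

lemma sum_cat_count:
  assumes "t \<in> count_vectors n"
  shows "sum (cat_count n t) (UNIV :: 'k::finite option set) = n"
  using assms by (simp add: UNIV_option_conv sum.reindex cat_count_def count_vectors_def)

lemma bij_betw_cat_count:
  "bij_betw (cat_count n) (count_vectors n) (weak_compositions n :: ('k::finite option \<Rightarrow> nat) set)"
proof (rule bij_betw_byWitness[where f' = "\<lambda>s. \<chi> i. s (Some i)"])
  show "cat_count n ` count_vectors n \<subseteq> (weak_compositions n :: ('k option \<Rightarrow> nat) set)"
    by (auto simp: weak_compositions_def sum_cat_count)
  show "(\<lambda>s. \<chi> i. s (Some i)) ` (weak_compositions n :: ('k option \<Rightarrow> nat) set) \<subseteq> count_vectors n"
    by (auto simp: weak_compositions_def count_vectors_def UNIV_option_conv sum.reindex)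
  show "\<forall>t\<in>count_vectors n. (\<chi> i. cat_count n t (Some (i::'k))) = t"
    by (auto simp: cat_count_def)
  show "\<forall>s\<in>weak_compositions n. cat_count n (\<chi> i. s (Some (i::'k))) = s"
    by (auto simp: weak_compositions_def cat_count_def UNIV_option_conv sum.reindex fun_eq_iff split: option.splits)
qed

lemma prior_pred_eq_integral:
  fixes \<pi> :: "real^'k::finite \<Rightarrow> real"
  assumes "t \<in> count_vectors n"
  shows "prior_pred \<pi> n t = (LINT \<theta>|lebesgue_on Theta. multinomial (cat_prob \<theta>) (cat_count n t) * \<pi> \<theta>)"
  unfolding prior_pred_def multinomial_def sum_cat_count[OF assms] monomial_def
  by (simp add: mult.assoc)

text \<open>
  The factor \<open>d\<close> is chosen before \<open>t\<close>: Dirichlet's formula cancels the factorials of the counts, so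
  all count vectors of total at most \<open>n\<close> share it, and comparing prior predictive probabilities
  means comparing Dirichlet means.
\<close>

lemma prior_pred_eq_dirichlet_mean:
  obtains d where "d > 0" "\<And>(\<pi> :: real^'k::finite \<Rightarrow> real) t. t \<in> count_vectors n \<Longrightarrow>
    prior_pred \<pi> n t = d * dirichlet_mean \<pi> (cat_count n t)"
proof (rule that[of "fact n * fact CARD('k) / fact (n + CARD('k)) * dirichlet_integral (\<lambda>_::'k option. 0)"])
  show "0 < fact n * fact CARD('k) / fact (n + CARD('k)) * dirichlet_integral (\<lambda>_::'k option. 0)"
    by (intro mult_pos_pos divide_pos_pos dirichlet_integral_0_pos) auto
  fix \<pi> :: "real^'k \<Rightarrow> real" and t :: "nat^'k" assume t: "t \<in> count_vectors n"
  let ?s = "cat_count n t"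
  have J: "dirichlet_integral ?s = fact CARD('k) * (\<Prod>c\<in>UNIV. fact (?s c)) * dirichlet_integral (\<lambda>_::'k option. 0)
      / fact (n + CARD('k))"
    using dirichlet_integral_eq[of ?s] unfolding sum_cat_count[OF t] by (simp add: field_simps)
  have "prior_pred \<pi> n t = fact n / (\<Prod>c\<in>UNIV. fact (?s c)) * dirichlet_integral ?s * dirichlet_mean \<pi> ?s"
    using dirichlet_integral_pos[of ?s]
    by (simp add: prior_pred_def dirichlet_mean_def monomial_def)
  also have "fact n / (\<Prod>c\<in>UNIV. fact (?s c)) * dirichlet_integral ?s
      = fact n * fact CARD('k) / fact (n + CARD('k)) * dirichlet_integral (\<lambda>_::'k option. 0)"
    unfolding J by (simp add: prod_zero_iff)
  finally show "prior_pred \<pi> n t = fact n * fact CARD('k) / fact (n + CARD('k)) *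
    dirichlet_integral (\<lambda>_::'k option. 0) * dirichlet_mean \<pi> ?s" .
qed

lemma observed_counts_in_count_vectors: "observed_counts x n \<in> (count_vectors n :: (nat^'k::finite) set)"
proof -
  have "(\<Sum>i\<in>(UNIV::'k set). card {j. j < n \<and> x j = Some i}) = card (\<Union>i. {j. j < n \<and> x j = Some (i::'k)})"
    by (rule card_UN_disjoint[symmetric]) auto
  also have "\<dots> \<le> card {..<n}" by (rule card_mono) auto
  finally show ?thesis by (simp add: count_vectors_def observed_counts_def)
qed

lemma cat_count_observed_counts:
  fixes x :: "nat \<Rightarrow> 'k::finite option"
  shows "cat_count n (observed_counts x n) c = card {j. j < n \<and> x j = c}"
proof (cases c)
  case None
  have "(\<Sum>d\<in>UNIV. card {j. j < n \<and> x j = d}) = card (\<Union>d. {j. j < n \<and> x j = d})"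
    by (rule card_UN_disjoint[symmetric]) auto
  also have "(\<Union>d. {j. j < n \<and> x j = d}) = {..<n}" by auto
  finally have "card {j. j < n \<and> x j = None} + (\<Sum>i\<in>UNIV. card {j. j < n \<and> x j = Some i}) = n"
    by (simp add: UNIV_option_conv sum.reindex)
  with None show ?thesis by (simp add: cat_count_def observed_counts_def)
qed (simp add: cat_count_def observed_counts_def)

section \<open>Prior and prior predictive probabilities as integrals\<close>

text \<open>
  The prior predictive measure is the mixture of multinomial distributions over the prior.
\<close>

lemma prior_pred_measure_eq_integral:
  fixes \<pi> :: "real^'k::finite \<Rightarrow> real"
  assumes int: "integrable (lebesgue_on Theta) \<pi>" and nonneg: "\<And>\<theta>. \<theta> \<in> Theta \<Longrightarrow> 0 \<le> \<pi> \<theta>"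
  shows "measure (prior_pred_measure \<pi> n) {t\<in>count_vectors n. cat_count n t \<in> S}
    = (LINT \<theta>|lebesgue_on Theta. \<pi> \<theta> * multinomial_mean (cat_prob \<theta>) n (indicator S))"
proof -
  let ?T = "{t\<in>count_vectors n. cat_count n t \<in> S}"
  have fin: "finite (count_vectors n :: (nat^'k) set)"
    using bij_betw_finite[OF bij_betw_cat_count] finite_weak_compositions by blast
  have nn: "0 \<le> prior_pred \<pi> n t" if "t \<in> count_vectors n" for t
    unfolding prior_pred_eq_integral[OF that]
    by (rule integral_nonneg_AE, rule AE_I2)
       (auto intro!: mult_nonneg_nonneg multinomial_nonneg nonneg less_imp_le[OF cat_prob_in_unit(1)])
  have int': "integrable (lebesgue_on Theta) (\<lambda>\<theta>. multinomial (cat_prob \<theta>) s * \<pi> \<theta>)" for s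
    unfolding multinomial_def mult.assoc by (intro integrable_mult_right integrable_monomial_mult int)
  have "measure (prior_pred_measure \<pi> n) ?T = (\<Sum>t\<in>?T. prior_pred \<pi> n t)"
    unfolding prior_pred_measure_def
    by (subst measure_point_measure_finite_if) (use fin nn in auto)
  also have "\<dots> = (\<Sum>t\<in>?T. LINT \<theta>|lebesgue_on Theta. multinomial (cat_prob \<theta>) (cat_count n t) * \<pi> \<theta>)"
    by (intro sum.cong) (auto simp: prior_pred_eq_integral)
  also have "\<dots> = (LINT \<theta>|lebesgue_on Theta. (\<Sum>t\<in>?T. multinomial (cat_prob \<theta>) (cat_count n t) * \<pi> \<theta>))"
    by (rule Bochner_Integration.integral_sum[symmetric]) (rule int')
  also have "(\<lambda>\<theta>. \<Sum>t\<in>?T. multinomial (cat_prob \<theta>) (cat_count n t) * \<pi> \<theta>)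
      = (\<lambda>\<theta>. \<pi> \<theta> * multinomial_mean (cat_prob \<theta>) n (indicator S))"
  proof
    fix \<theta>
    have "(\<Sum>t\<in>?T. multinomial (cat_prob \<theta>) (cat_count n t) * \<pi> \<theta>)
        = \<pi> \<theta> * (\<Sum>t\<in>count_vectors n. multinomial (cat_prob \<theta>) (cat_count n t) * indicator S (cat_count n t))"
      unfolding sum_distrib_left
      by (rule sum.mono_neutral_cong_left) (use fin in \<open>auto simp: indicator_def\<close>)
    also have "(\<Sum>t\<in>count_vectors n. multinomial (cat_prob \<theta>) (cat_count n t) * indicator S (cat_count n t))
        = multinomial_mean (cat_prob \<theta>) n (indicator S)"
      unfolding multinomial_mean_def by (rule sum.reindex_bij_betw[OF bij_betw_cat_count])
    finally show "(\<Sum>t\<in>?T. multinomial (cat_prob \<theta>) (cat_count n t) * \<pi> \<theta>)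
      = \<pi> \<theta> * multinomial_mean (cat_prob \<theta>) n (indicator S)" .
  qed
  finally show ?thesis .
qed

lemma prior_measure_eq_integral:
  fixes \<pi> :: "real^'k::finite \<Rightarrow> real"
  assumes meas: "\<pi> \<in> borel_measurable (lebesgue_on Theta)" and nonneg: "\<And>\<theta>. \<theta> \<in> Theta \<Longrightarrow> 0 \<le> \<pi> \<theta>"
    and Q: "Measurable.pred (lebesgue_on Theta) Q"
  shows "measure (prior_measure \<pi>) {\<theta>\<in>Theta. Q \<theta>} = (LINT \<theta>|lebesgue_on Theta. \<pi> \<theta> * of_bool (Q \<theta>))"
proof -
  have A: "{\<theta>\<in>Theta. Q \<theta>} \<in> sets (lebesgue_on Theta)"
    using predE[OF Q] by simp
  have "measure (prior_measure \<pi>) {\<theta>\<in>Theta. Q \<theta>} = (LINT \<theta>|prior_measure \<pi>. indicator {\<theta>\<in>Theta. Q \<theta>} \<theta>)"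
  proof -
    have "{\<theta>\<in>Theta. Q \<theta>} \<inter> space (prior_measure \<pi>) = {\<theta>\<in>Theta. Q \<theta>}"
      by (auto simp: prior_measure_def)
    then show ?thesis by simp
  qed
  also have "\<dots> = (LINT \<theta>|lebesgue_on Theta. \<pi> \<theta> *\<^sub>R indicator {\<theta>\<in>Theta. Q \<theta>} \<theta>)"
    unfolding prior_measure_def
    by (rule integral_density) (use A meas nonneg in \<open>auto intro!: AE_I2\<close>)
  also have "\<dots> = (LINT \<theta>|lebesgue_on Theta. \<pi> \<theta> * of_bool (Q \<theta>))"
    by (intro Bochner_Integration.integral_cong) (auto simp: indicator_def)
  finally show ?thesis .
qed

section \<open>Convergence of the predictive probability\<close>

text \<open>
  When the frequencies are near \<open>\<theta>\<close>, the Dirichlet mean is within \<open>\<epsilon> = \<bar>\<pi> \<theta> - l\<bar>/2\<close> of \<open>\<pi> \<theta>\<close>, and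
  eventually \<open>L n\<close> is within \<open>\<epsilon>\<close> of \<open>l\<close>.  The comparison then has the same outcome as that of
  \<open>\<pi> \<theta>\<close> with \<open>l\<close>, and the remaining counts have probability of order \<open>1/n\<close>.
\<close>

lemma region_probability_tendsto:
  fixes \<pi> :: "real^'k::finite \<Rightarrow> real"
  assumes meas: "\<pi> \<in> borel_measurable (lebesgue_on Theta)"
    and bnd: "\<And>\<theta>. \<theta> \<in> Theta \<Longrightarrow> 0 \<le> \<pi> \<theta> \<and> \<pi> \<theta> \<le> B"
    and \<theta>: "\<theta> \<in> Theta_c \<pi>" and neq: "\<pi> \<theta> \<noteq> l" and L: "L \<longlonglongrightarrow> l"
  shows "(\<lambda>n. multinomial_mean (cat_prob \<theta>) n (indicator {s. dirichlet_mean \<pi> s \<le> L n}))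
    \<longlonglongrightarrow> of_bool (\<pi> \<theta> \<le> l)"
proof -
  have \<theta>T: "\<theta> \<in> Theta" using \<theta> by (simp add: Theta_c_def)
  note p = less_imp_le[OF cat_prob_in_unit(1)[OF \<theta>T]] sum_cat_prob[of \<theta>]
  define \<epsilon> where "\<epsilon> = \<bar>\<pi> \<theta> - l\<bar> / 2"
  have \<epsilon>: "\<epsilon> > 0" using neq by (simp add: \<epsilon>_def)
  obtain \<delta> where \<delta>: "\<delta> > 0" "\<forall>\<^sub>F n in sequentially. \<forall>s\<in>weak_compositions n.
       (\<forall>c. \<bar>real (s c) / real n - cat_prob \<theta> c\<bar> < \<delta>) \<longrightarrow> \<bar>dirichlet_mean \<pi> s - \<pi> \<theta>\<bar> < \<epsilon>"
    using dirichlet_mean_near[OF meas bnd \<theta> \<epsilon>] by blast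
  have L_near: "\<forall>\<^sub>F n in sequentially. dist (L n) l < \<epsilon>" using L \<epsilon> by (rule tendstoD)
  let ?g = "\<lambda>n. multinomial_mean (cat_prob \<theta>) n (indicator {s. dirichlet_mean \<pi> s \<le> L n})"
  have "\<forall>\<^sub>F n in sequentially. norm (?g n - of_bool (\<pi> \<theta> \<le> l)) \<le> real CARD('k option) / \<delta>\<^sup>2 * (1 / real n)"
    using \<delta>(2) L_near eventually_gt_at_top[of 0]
  proof eventually_elim
    case (elim n)
    show ?case unfolding real_norm_def
    proof (rule multinomial_concentration[OF p \<open>0 < n\<close> \<delta>(1)])
      fix s :: "'k option \<Rightarrow> nat"
      assume "s \<in> weak_compositions n" "\<forall>c. \<bar>real (s c) / real n - cat_prob \<theta> c\<bar> < \<delta>"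
      with elim(1) have "\<bar>dirichlet_mean \<pi> s - \<pi> \<theta>\<bar> < \<epsilon>" by blast
      with elim(2) have "dirichlet_mean \<pi> s \<le> L n \<longleftrightarrow> \<pi> \<theta> \<le> l"
        unfolding \<epsilon>_def dist_real_def abs_less_iff by (auto simp: abs_if split: if_splits)
      then show "indicator {s. dirichlet_mean \<pi> s \<le> L n} s = (of_bool (\<pi> \<theta> \<le> l) :: real)"
        by (simp add: indicator_def)
    qed (auto simp: indicator_def)
  qed
  moreover have "(\<lambda>n. real CARD('k option) / \<delta>\<^sup>2 * (1 / real n)) \<longlonglongrightarrow> 0"
    by (intro tendsto_mult_right_zero lim_1_over_n)
  ultimately have "(\<lambda>n. ?g n - of_bool (\<pi> \<theta> \<le> l)) \<longlonglongrightarrow> 0"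
    by (rule Lim_null_comparison)
  then show ?thesis by (simp add: LIM_zero_iff)
qed

theorem theorem1:
  fixes \<pi> :: "real ^ 'k::finite \<Rightarrow> real"
    and \<theta>true :: "real ^ 'k"
    and P :: "'w measure"
    and X :: "nat \<Rightarrow> 'w \<Rightarrow> 'k option"
  assumes prior: "prior_density \<pi>"
    and A1: "\<exists>B>0. \<forall>\<theta>\<in>Theta. \<pi> \<theta> \<le> B"
    and A2: "Theta_d \<pi> \<in> null_sets lebesgue"
    and A3: "\<And>l. l \<ge> 0 \<Longrightarrow> measure (prior_measure \<pi>) {\<theta>\<in>Theta. \<pi> \<theta> = l} = 0"
    and true_cont: "\<theta>true \<in> Theta_c \<pi>"
    and P: "prob_space P"
    and indep: "prob_space.indep_vars P (\<lambda>_. count_space UNIV) X UNIV"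
    and categorical: "\<And>i c. measure P {\<omega>\<in>space P. X i \<omega> = c} = cat_prob \<theta>true c"
  shows "AE \<omega> in P.
    (\<lambda>n. measure (prior_pred_measure \<pi> n)
           {t\<in>count_vectors n.
              prior_pred \<pi> n t \<le> prior_pred \<pi> n (observed_counts (\<lambda>i. X i \<omega>) n)})
    \<longlonglongrightarrow> measure (prior_measure \<pi>) {\<theta>\<in>Theta. \<pi> \<theta> \<le> \<pi> \<theta>true}"
proof -
  obtain B where B: "\<And>\<theta>. \<theta> \<in> Theta \<Longrightarrow> \<pi> \<theta> \<le> B" using A1 by blast
  have meas [measurable]: "\<pi> \<in> borel_measurable (lebesgue_on Theta)"
    and nonneg: "\<And>\<theta>. \<theta> \<in> Theta \<Longrightarrow> 0 \<le> \<pi> \<theta>"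
    using prior by (auto simp: prior_density_def)
  have bnd: "\<And>\<theta>. \<theta> \<in> Theta \<Longrightarrow> 0 \<le> \<pi> \<theta> \<and> \<pi> \<theta> \<le> B" using B nonneg by blast
  have int: "integrable (lebesgue_on Theta) \<pi>"
    by (rule integrable_on_Theta[OF meas, of B]) (use bnd in auto)
  define l where "l = \<pi> \<theta>true"
  have l: "l \<ge> 0" using true_cont nonneg by (auto simp: l_def Theta_c_def)
  have cont_AE: "AE \<theta> in lebesgue_on Theta. \<theta> \<in> Theta_c \<pi>"
  proof -
    have "AE \<theta> in lebesgue. \<theta> \<in> Theta \<longrightarrow> \<theta> \<in> Theta_c \<pi>"
      using AE_not_in[OF A2] by eventually_elim (auto simp: Theta_c_def Theta_d_def)
    then show ?thesis by (simp add: AE_restrict_space_iff Theta_lmeasurable_set)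
  qed
  \<comment> \<open>Prior-null, not Lebesgue-null: the density may vanish on a set of positive volume when \<open>l = 0\<close>.\<close>
  have level_AE: "AE \<theta> in lebesgue_on Theta. \<pi> \<theta> = l \<longrightarrow> \<pi> \<theta> = 0"
  proof -
    have "(LINT \<theta>|lebesgue_on Theta. \<pi> \<theta> * of_bool (\<pi> \<theta> = l)) = 0"
      using A3[OF l] by (subst (asm) prior_measure_eq_integral[OF meas nonneg]) auto
    moreover have "integrable (lebesgue_on Theta) (\<lambda>\<theta>. \<pi> \<theta> * of_bool (\<pi> \<theta> = l))"
      by (rule Bochner_Integration.integrable_bound[OF int]) auto
    ultimately have "AE \<theta> in lebesgue_on Theta. \<pi> \<theta> * of_bool (\<pi> \<theta> = l) = 0"
      using nonneg l by (subst (asm) integral_nonneg_eq_0_iff_AE) (auto intro!: AE_I2)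
    then show ?thesis by eventually_elim auto
  qed
  interpret P: prob_space P by (rule P)
  have "AE \<omega> in P. \<forall>c. (\<lambda>n. real (card {j. j < n \<and> X j \<omega> = c}) / real n) \<longlonglongrightarrow> cat_prob \<theta>true c"
    unfolding AE_all_countable by (intro allI P.strong_law_frequency[OF indep] categorical)
  then show ?thesis
  proof eventually_elim
    case (elim \<omega>)
    define obs where "obs n = cat_count n (observed_counts (\<lambda>i. X i \<omega>) n)" for n
    define L where "L n = dirichlet_mean \<pi> (obs n)" for n
    have L: "L \<longlonglongrightarrow> l"
    proof (rule tendstoI)
      fix \<epsilon> :: real assume \<epsilon>: "\<epsilon> > 0"
      obtain \<delta> where \<delta>: "\<delta> > 0" "\<forall>\<^sub>F n in sequentially. \<forall>s\<in>weak_compositions n.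
         (\<forall>c. \<bar>real (s c) / real n - cat_prob \<theta>true c\<bar> < \<delta>) \<longrightarrow> \<bar>dirichlet_mean \<pi> s - \<pi> \<theta>true\<bar> < \<epsilon>"
        using dirichlet_mean_near[OF meas bnd true_cont \<epsilon>] by blast
      \<comment> \<open>There are finitely many categories, so their frequencies are eventually close simultaneously.\<close>
      have "\<forall>\<^sub>F n in sequentially. \<forall>c\<in>UNIV. dist (real (obs n c) / real n) (cat_prob \<theta>true c) < \<delta>"
        unfolding obs_def cat_count_observed_counts
        by (intro eventually_ball_finite ballI tendstoD \<delta>(1)) (use elim in auto)
      then show "\<forall>\<^sub>F n in sequentially. dist (L n) l < \<epsilon>"
        using \<delta>(2)
      proof eventually_elim
        case (elim n)
        have "obs n \<in> weak_compositions n"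
          by (simp add: obs_def weak_compositions_def sum_cat_count observed_counts_in_count_vectors)
        with elim show ?case by (simp add: L_def l_def dist_real_def)
      qed
    qed
    let ?S = "\<lambda>n. {s. dirichlet_mean \<pi> s \<le> L n}"
    have region: "{t\<in>count_vectors n. prior_pred \<pi> n t \<le> prior_pred \<pi> n (observed_counts (\<lambda>i. X i \<omega>) n)}
        = {t\<in>count_vectors n. cat_count n t \<in> ?S n}" for n
    proof -
      obtain d where d: "d > 0" "\<And>(\<pi> :: real^'k \<Rightarrow> real) t. t \<in> count_vectors n \<Longrightarrow>
          prior_pred \<pi> n t = d * dirichlet_mean \<pi> (cat_count n t)"
        using prior_pred_eq_dirichlet_mean by blast
      show ?thesis
        using d(1) by (auto simp: d(2) observed_counts_in_count_vectors L_def obs_def)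
    qed
    let ?g = "\<lambda>n \<theta>. multinomial_mean (cat_prob \<theta>) n (indicator (?S n))"
    have "(\<lambda>n. LINT \<theta>|lebesgue_on Theta. \<pi> \<theta> * ?g n \<theta>)
        \<longlonglongrightarrow> (LINT \<theta>|lebesgue_on Theta. \<pi> \<theta> * of_bool (\<pi> \<theta> \<le> l))"
    proof (rule integral_dominated_convergence[where w = \<pi>])
      have "(\<lambda>\<theta>. ?g n \<theta>) \<in> borel_measurable (lebesgue_on Theta)" for n
        unfolding multinomial_mean_def multinomial_def
        by (intro borel_measurable_on_Theta) measurable
      then show "(\<lambda>\<theta>. \<pi> \<theta> * ?g n \<theta>) \<in> borel_measurable (lebesgue_on Theta)" for n
        using meas by (intro borel_measurable_times)
      show "AE \<theta> in lebesgue_on Theta. (\<lambda>n. \<pi> \<theta> * ?g n \<theta>) \<longlonglongrightarrow> \<pi> \<theta> * of_bool (\<pi> \<theta> \<le> l)"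
        using cont_AE level_AE
      proof eventually_elim
        case (elim \<theta>)
        show ?case
        proof (cases "\<pi> \<theta> = l")
          case False
          show ?thesis by (intro tendsto_mult_left region_probability_tendsto[OF meas bnd elim(1) False L])
        qed (use elim in simp)
      qed
      show "AE \<theta> in lebesgue_on Theta. norm (\<pi> \<theta> * ?g n \<theta>) \<le> \<pi> \<theta>" for n
      proof (rule AE_I2)
        fix \<theta> :: "real^'k" assume "\<theta> \<in> space (lebesgue_on Theta)"
        then have \<theta>: "\<theta> \<in> Theta" by simp
        note g = multinomial_mean_indicator_bounds[OF less_imp_le[OF cat_prob_in_unit(1)[OF \<theta>]] sum_cat_prob, of n "?S n"]
        show "norm (\<pi> \<theta> * ?g n \<theta>) \<le> \<pi> \<theta>"
          using g nonneg[OF \<theta>] by (simp add: abs_mult mult_left_le)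
      qed
    qed (use int in auto)
    moreover have "measure (prior_pred_measure \<pi> n) {t\<in>count_vectors n.
          prior_pred \<pi> n t \<le> prior_pred \<pi> n (observed_counts (\<lambda>i. X i \<omega>) n)}
        = (LINT \<theta>|lebesgue_on Theta. \<pi> \<theta> * ?g n \<theta>)" for n
      unfolding region by (rule prior_pred_measure_eq_integral[OF int nonneg])
    moreover have "measure (prior_measure \<pi>) {\<theta>\<in>Theta. \<pi> \<theta> \<le> \<pi> \<theta>true}
        = (LINT \<theta>|lebesgue_on Theta. \<pi> \<theta> * of_bool (\<pi> \<theta> \<le> l))"
      unfolding l_def by (rule prior_measure_eq_integral[OF meas nonneg]) measurable
    ultimately show ?case by simp
  qed
qed

end
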